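(* Let $n\ge 1$ be an integer and let $G_n$ be the group $$G_n=\langle \sigma,\tau,\rho:\ \rho^4=\sigma^8=\tau^{2^{n+2}}=1,\ \sigma^4=\tau^{2^{n+1}},\ \rho^2=\tau^{2^n}\sigma^2,\ [\tau,\sigma]=1,\ [\rho,\sigma]=\sigma^{-2},\ [\rho,\tau]=\tau^2\rangle .$$ Then $G_n$ has exactly seven subgroups of index $2$, namely the following subgroups $H_{1,2},\dots,H_{7,2}$, whose derived subgroups and abelianizations are as indicated: 1. $H_{1,2}=\langle\sigma,\tau\rangle$, $H_{1,2}'=\langle 1\rangle$, $H_{1,2}/H_{1,2}'$ is of type $(2^2,2^{n+2})$. 2. If $n=1$: $H_{2,2}=\langle\sigma,\rho\rangle$, $H_{2,2}'=\langle\sigma^2\rangle$, $H_{2,2}/H_{2,2}'$ is of type $(2,4)$. If $n\ge2$: $H_{2,2}=\langle\sigma,\tau^2,\rho\rangle$, $H_{2,2}'=\langle\sigma^2,\tau^4\rangle$, $H_{2,2}/H_{2,2}'$ is of type $(2,2,2)$. 3. $H_{3,2}=\langle\rho,\tau\rangle$, $H_{3,2}'=\langle\tau^2\rangle$, $H_{3,2}/H_{3,2}'$ is of type $(2,4)$. 4. If $n=1$: $H_{4,2}=\langle\sigma\tau,\rho,\sigma^2\rangle$, $H_{4,2}'=\langle(\sigma\tau)^2,\sigma^4\rangle$, $H_{4,2}/H_{4,2}'$ is of type $(2,2,2)$. If $n\ge2$: $H_{4,2}=\langle\sigma\tau,\rho\rangle$, $H_{4,2}'=\langle(\sigma\tau)^2\rangle$,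 $H_{4,2}/H_{4,2}'$ is of type $(2,4)$. 5. $H_{5,2}=\langle\sigma\rho,\tau\rangle$, $H_{5,2}'=\langle\tau^2\rangle$, $H_{5,2}/H_{5,2}'$ is of type $(2,4)$. 6. If $n=1$: $H_{6,2}=\langle\tau\rho,\sigma\rangle$, $H_{6,2}'=\langle\sigma^2\rangle$, $H_{6,2}/H_{6,2}'$ is of type $(2,4)$. If $n\ge2$: $H_{6,2}=\langle\tau\rho,\sigma,\tau^2\rangle$, $H_{6,2}'=\langle\sigma^2,\tau^4\rangle$, $H_{6,2}/H_{6,2}'$ is of type $(2,2,2)$. 7. If $n=1$: $H_{7,2}=\langle\sigma\tau,\tau\rho,\sigma^2\rangle$, $H_{7,2}'=\langle\sigma^4,(\sigma\tau)^2\rangle$, $H_{7,2}/H_{7,2}'$ is of type $(2,2,2)$. If $n\ge2$: $H_{7,2}=\langle\sigma\tau,\tau\rho\rangle$, $H_{7,2}'=\langle(\sigma\tau)^2\rangle$, $H_{7,2}/H_{7,2}'$ is of type $(2,4)$.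
   Context: Commutators are $[x,y]=x^{-1}y^{-1}xy$, and $H'=[H,H]$ is the derived subgroup of $H$. A finite abelian group is of type $(a_1,\dots,a_r)$ if it is isomorphic to $\mathbb{Z}/a_1\mathbb{Z}\times\cdots\times\mathbb{Z}/a_r\mathbb{Z}$. *)

theory Defs
  imports "HOL-Algebra.Algebra"
begin

section \<open>Free groups\<close>

text \<open>
  A letter \<open>(x, True)\<close> stands for the generator \<open>x\<close>, and \<open>(x, False)\<close> for its formal inverse.
  The free group consists of the words modulo insertion and deletion of pairs of
  mutually inverse adjacent letters.
\<close>

type_synonym 'a word = "('a \<times> bool) list"

inductive cancels :: "'a word \<Rightarrow> 'a word \<Rightarrow> bool" where
  "cancels (u @ [(x, b), (x, \<not> b)] @ v) (u @ v)"

definition word_equiv :: "('a word \<times> 'a word) set" where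
  "word_equiv = {(u, v). equivclp cancels u v}"

definition word_class :: "'a word \<Rightarrow> 'a word set" where
  "word_class w = word_equiv `` {w}"

definition free_group :: "'a word set monoid" where
  "free_group =
     \<lparr>carrier = UNIV // word_equiv,
      monoid.mult = (\<lambda>A B. \<Union>u\<in>A. \<Union>v\<in>B. word_class (u @ v)),
      one = word_class []\<rparr>"

definition free_gen :: "'a \<Rightarrow> 'a word set" where
  "free_gen x = word_class [(x, True)]"

lemma equiv_word_equiv: "equiv UNIV (word_equiv :: ('a word \<times> 'a word) set)"
proof (rule equivI)
  show "refl_on UNIV (word_equiv :: ('a word \<times> 'a word) set)"
    by (rule refl_onI) (simp add: word_equiv_def)
  show "sym (word_equiv :: ('a word \<times> 'a word) set)"
    by (rule symI) (simp add: word_equiv_def equivclp_sym)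
  show "trans (word_equiv :: ('a word \<times> 'a word) set)"
    by (rule transI) (simp add: word_equiv_def, erule (1) equivclp_trans)
qed simp

lemma equivclp_cancels_append:
  assumes "equivclp cancels u v"
  shows "equivclp cancels (p @ u @ q) (p @ v @ q)"
  using assms
proof (induction rule: equivclp_induct)
  case base
  show ?case by simp
next
  case (step y z)
  have ctxt: "cancels (p @ a @ q) (p @ b @ q)" if "cancels a b" for a b
    using that
  proof cases
    case (1 u x c v)
    then show ?thesis
      using cancels.intros[of "p @ u" x c "v @ q"] by simp
  qed
  from step.hyps(2) have "equivclp cancels (p @ y @ q) (p @ z @ q)"
    using ctxt r_into_equivclp converse_r_into_equivclp by metis
  with step.IH show ?case by (rule equivclp_trans)
qed

lemma word_class_eq_iff: "word_class u = word_class v \<longleftrightarrow> equivclp cancels u v"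
  unfolding word_class_def
  using eq_equiv_class_iff[OF equiv_word_equiv, of u v] by (simp add: word_equiv_def)

lemma in_word_class_iff: "v \<in> word_class u \<longleftrightarrow> equivclp cancels u v"
  by (simp add: word_class_def word_equiv_def)

lemma carrier_free_group: "carrier free_group = range word_class"
  by (auto simp: free_group_def quotient_def word_class_def)

lemma one_free_group: "\<one>\<^bsub>free_group\<^esub> = word_class []"
  by (simp add: free_group_def)

lemma mult_free_group:
  "word_class u \<otimes>\<^bsub>free_group\<^esub> word_class v = word_class (u @ v)"
proof -
  have *: "word_class (u' @ v') = word_class (u @ v)"
    if "u' \<in> word_class u" "v' \<in> word_class v" for u' v'
  proof -
    have "equivclp cancels (u @ v) (u' @ v)"
      using equivclp_cancels_append[of u u' "[]" v] that by (simp add: in_word_class_iff)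
    moreover have "equivclp cancels (u' @ v) (u' @ v')"
      using equivclp_cancels_append[of v v' u' "[]"] that by (simp add: in_word_class_iff)
    ultimately show ?thesis
      by (metis word_class_eq_iff)
  qed
  have "u \<in> word_class u" "v \<in> word_class v"
    by (simp_all add: in_word_class_iff)
  then have "(\<Union>u'\<in>word_class u. \<Union>v'\<in>word_class v. word_class (u' @ v')) = word_class (u @ v)"
    using * by blast
  then show ?thesis
    by (simp add: free_group_def)
qed

lemma group_free_group: "group free_group"
proof (rule groupI)
  fix x :: "'a word set"
  assume "x \<in> carrier free_group"
  then obtain w where w: "x = word_class w"
    by (auto simp: carrier_free_group)
  have "\<exists>w'. equivclp cancels (w' @ w) []"
  proof (induction w)
    case Nil
    show ?case by (rule exI[of _ "[]"]) simp
  next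
    case (Cons a w)
    obtain y c where a: "a = (y, c)" by fastforce
    from Cons obtain w' where w': "equivclp cancels (w' @ w) []" by blast
    have "cancels (w' @ [(y, \<not> c), (y, \<not> \<not> c)] @ w) (w' @ w)"
      by (rule cancels.intros)
    then have "equivclp cancels ((w' @ [(y, \<not> c)]) @ a # w) (w' @ w)"
      by (simp add: a r_into_equivclp)
    with w' show ?case by (blast intro: equivclp_trans)
  qed
  then show "\<exists>y\<in>carrier free_group. y \<otimes>\<^bsub>free_group\<^esub> x = \<one>\<^bsub>free_group\<^esub>"
    by (auto simp: w carrier_free_group mult_free_group one_free_group word_class_eq_iff)
qed (auto simp: carrier_free_group mult_free_group one_free_group)

lemma free_gen_closed: "free_gen x \<in> carrier free_group"
  by (simp add: free_gen_def carrier_free_group)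


section \<open>Presentations by generators and relations\<close>

definition normal_closure :: "('a, 'b) monoid_scheme \<Rightarrow> 'a set \<Rightarrow> 'a set" where
  "normal_closure G A = \<Inter>{N. N \<lhd> G \<and> A \<subseteq> N}"

text \<open>A pair \<open>(u, v)\<close> in \<open>R\<close> is the relation \<open>u = v\<close>.\<close>

definition relation_subgroup :: "('a word set \<times> 'a word set) set \<Rightarrow> 'a word set set" where
  "relation_subgroup R =
     normal_closure free_group {u \<otimes>\<^bsub>free_group\<^esub> inv\<^bsub>free_group\<^esub> v | u v. (u, v) \<in> R}"

definition presented_group :: "('a word set \<times> 'a word set) set \<Rightarrow> 'a word set set monoid" where
  "presented_group R = free_group Mod relation_subgroup R"

definition presented_gen :: "('a word set \<times> 'a word set) set \<Rightarrow> 'a \<Rightarrow> 'a word set set" where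
  "presented_gen R x = relation_subgroup R #>\<^bsub>free_group\<^esub> free_gen x"

lemma (in group) normal_closure_normal:
  assumes "A \<subseteq> carrier G"
  shows "normal_closure G A \<lhd> G"
proof -
  have ne: "{N. N \<lhd> G \<and> A \<subseteq> N} \<noteq> {}"
    using assms normal_self by blast
  have "subgroup (normal_closure G A) G"
    unfolding normal_closure_def
    using ne by (intro subgroups_Inter) (auto intro: normal_imp_subgroup)
  then show ?thesis
    unfolding normal_closure_def
    by (intro normal_invI) (auto intro: normal.inv_op_closed2)
qed

lemma relation_subgroup_normal:
  assumes "R \<subseteq> carrier free_group \<times> carrier free_group"
  shows "relation_subgroup R \<lhd> free_group"
proof -
  interpret F: group "free_group :: 'a word set monoid" by (rule group_free_group)
  show ?thesis
    unfolding relation_subgroup_def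
    using assms by (intro F.normal_closure_normal) auto
qed

lemma group_presented_group:
  assumes "R \<subseteq> carrier free_group \<times> carrier free_group"
  shows "group (presented_group R)"
  unfolding presented_group_def
  by (rule normal.factorgroup_is_group[OF relation_subgroup_normal[OF assms]])


section \<open>The groups \<open>G\<^sub>n\<close>\<close>

definition commutator :: "('a, 'b) monoid_scheme \<Rightarrow> 'a \<Rightarrow> 'a \<Rightarrow> 'a" where
  "commutator G x y = inv\<^bsub>G\<^esub> x \<otimes>\<^bsub>G\<^esub> inv\<^bsub>G\<^esub> y \<otimes>\<^bsub>G\<^esub> x \<otimes>\<^bsub>G\<^esub> y"

datatype gen = Gen_sigma | Gen_tau | Gen_rho

definition Gn_relations :: "nat \<Rightarrow> (gen word set \<times> gen word set) set" where
  "Gn_relations n =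
    (let F = free_group; s = free_gen Gen_sigma; t = free_gen Gen_tau; r = free_gen Gen_rho in
     {(r [^]\<^bsub>F\<^esub> (4::nat), \<one>\<^bsub>F\<^esub>),
      (s [^]\<^bsub>F\<^esub> (8::nat), \<one>\<^bsub>F\<^esub>),
      (t [^]\<^bsub>F\<^esub> ((2::nat) ^ (n + 2)), \<one>\<^bsub>F\<^esub>),
      (s [^]\<^bsub>F\<^esub> (4::nat), t [^]\<^bsub>F\<^esub> ((2::nat) ^ (n + 1))),
      (r [^]\<^bsub>F\<^esub> (2::nat), t [^]\<^bsub>F\<^esub> ((2::nat) ^ n) \<otimes>\<^bsub>F\<^esub> s [^]\<^bsub>F\<^esub> (2::nat)),
      (commutator F t s, \<one>\<^bsub>F\<^esub>),
      (commutator F r s, s [^]\<^bsub>F\<^esub> (-2::int)),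
      (commutator F r t, t [^]\<^bsub>F\<^esub> (2::nat))})"

definition Gn :: "nat \<Rightarrow> gen word set set monoid" where
  "Gn n = presented_group (Gn_relations n)"

definition Gn_sigma :: "nat \<Rightarrow> gen word set set" where
  "Gn_sigma n = presented_gen (Gn_relations n) Gen_sigma"

definition Gn_tau :: "nat \<Rightarrow> gen word set set" where
  "Gn_tau n = presented_gen (Gn_relations n) Gen_tau"

definition Gn_rho :: "nat \<Rightarrow> gen word set set" where
  "Gn_rho n = presented_gen (Gn_relations n) Gen_rho"

lemma group_Gn: "group (Gn n)"
proof -
  interpret F: group "free_group :: gen word set monoid" by (rule group_free_group)
  show ?thesis
    unfolding Gn_def
    by (rule group_presented_group)
       (auto simp: Gn_relations_def Let_def commutator_def free_gen_closed)
qed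


section \<open>Abelianizations and types of finite abelian groups\<close>

text \<open>
  The library's \<^const>\<open>derived\<close> is generated by the elements \<open>x y x\<inverse> y\<inverse>\<close>; for a subgroup \<open>H\<close> these
  are the same elements as the \<open>x\<inverse> y\<inverse> x y\<close>.
\<close>

definition abelianization :: "('a, 'b) monoid_scheme \<Rightarrow> 'a set \<Rightarrow> 'a set monoid" where
  "abelianization G H = (G\<lparr>carrier := H\<rparr>) Mod (derived G H)"

definition of_type :: "('a, 'b) monoid_scheme \<Rightarrow> nat list \<Rightarrow> bool" where
  "of_type A as \<longleftrightarrow> comm_group A \<and> finite (carrier A) \<and>
     A \<cong> product_group {..<length as} (\<lambda>i. integer_mod_group (as ! i))"

end

theory Submission
  imports Defs
begin

text \<open>
  The subgroup \<open>A = \<langle>\<sigma>, \<tau>\<rangle>\<close> is abelian, and the last two relations say that \<open>\<rho>\<close> acts on it by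
  \<open>\<sigma> \<mapsto> \<sigma>\<^sup>3\<close>, \<open>\<tau> \<mapsto> \<tau>\<inverse>\<close>. Hence every element has the form \<open>\<sigma>\<^sup>a \<tau>\<^sup>b \<rho>\<^sup>c\<close> with integer exponents, and
  products are computed by a formula that only sees the parity of \<open>c\<close>. Everything rests on knowing
  exactly when two such expressions agree: \<open>\<sigma>\<^sup>a \<tau>\<^sup>b = 1\<close> holds precisely when \<open>(a, b)\<close> lies in the lattice
  spanned by \<open>(8, 0)\<close> and \<open>(4, 2\<^bsup>n+1\<^esup>)\<close>, and \<open>\<rho>\<close> is not in \<open>A\<close>. That no further collapse occurs is
  shown by mapping \<open>G\<^sub>n\<close> to an explicit group of triples of residues, of order \<open>2\<^bsup>n+5\<^esup>\<close>, in which \<open>A\<close>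
  becomes \<open>\<int>/4 \<times> \<int>/2\<^bsup>n+2\<^esup>\<close>.

  The two sides of each relation have the same exponents of \<open>\<sigma>\<close>, \<open>\<tau>\<close>, \<open>\<rho>\<close> modulo 2, so for each of the seven nonzero
  linear forms modulo 2 the elements on which it vanishes form a subgroup of index two. Conversely, a
  subgroup \<open>K\<close> of index two is a set with \<open>xy \<in> K \<longleftrightarrow> (x \<in> K \<longleftrightarrow> y \<in> K)\<close>, and such a set is determined by which
  generators it contains. This gives the count of seven (\<open>index_2_subgroups\<close>).

  Commutators of normal forms lie in \<open>A\<close> and are given by a bilinear formula (\<open>nf_commute\<close>). For each
  of the subgroups, the derived subgroup is therefore the set of all \<open>\<sigma>\<^sup>a \<tau>\<^sup>b\<close> with \<open>(a, b)\<close> in a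
  lattice between the relation lattice and \<open>\<int>\<^sup>2\<close>, and the criterion for equality turns membership
  in it into congruences for the exponents (\<open>nf_in_lattice_subgroup\<close>). From these congruences the type of the abelianization
  can be read off: it suffices to exhibit elements that generate modulo the derived subgroup and whose
  only relations there are the expected divisibilities (\<open>of_type_abelianizationI\<close>).

  Only four of the seven subgroups need to be treated. The relations are invariant under
  \<open>\<rho> \<mapsto> \<tau>\<rho>\<close> and under \<open>(\<sigma>, \<rho>) \<mapsto> (\<sigma>\<inverse>, \<sigma>\<rho>)\<close>. The first substitution carries \<open>H\<^sub>2\<close> and \<open>H\<^sub>4\<close> to \<open>H\<^sub>6\<close> and \<open>H\<^sub>7\<close>, the
  second carries \<open>H\<^sub>3\<close> to \<open>H\<^sub>5\<close>.
\<close>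


section \<open>Homomorphisms out of a presented group\<close>

fun eval_word :: "('b, 'c) monoid_scheme \<Rightarrow> ('a \<Rightarrow> 'b) \<Rightarrow> 'a word \<Rightarrow> 'b" where
  "eval_word M f [] = \<one>\<^bsub>M\<^esub>"
| "eval_word M f ((x, b) # w) = (if b then f x else inv\<^bsub>M\<^esub> f x) \<otimes>\<^bsub>M\<^esub> eval_word M f w"

context group
begin

lemma eval_word_closed: "range f \<subseteq> carrier G \<Longrightarrow> eval_word G f w \<in> carrier G"
  by (induction w) (auto simp: image_subset_iff)

lemma eval_word_append:
  assumes "range f \<subseteq> carrier G"
  shows "eval_word G f (u @ v) = eval_word G f u \<otimes> eval_word G f v"
  using assms eval_word_closed[OF assms]
  by (induction u) (auto simp: image_subset_iff m_assoc)

lemma eval_word_cancels: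
  assumes "range f \<subseteq> carrier G" "equivclp cancels u v"
  shows "eval_word G f u = eval_word G f v"
  using assms(2)
proof (induction rule: equivclp_induct)
  case (step y z)
  have "eval_word G f p = eval_word G f q" if "cancels p q" for p q
    using that
  proof cases
    case (1 u x b v)
    have "f x \<in> carrier G"
      using assms(1) by auto
    then have "eval_word G f [(x, b), (x, \<not> b)] = \<one>"
      by simp
    then have "eval_word G f ([(x, b), (x, \<not> b)] @ v) = eval_word G f v"
      unfolding eval_word_append[OF assms(1)] using eval_word_closed[OF assms(1)] by simp
    then show ?thesis
      unfolding 1 eval_word_append[OF assms(1), of u] by simp
  qed
  with step show ?case by metis
qed simp

text \<open>
  A value can be computed from any word that represents a class, because evaluation respects cancellation.
\<close>

lemma free_group_hom:
  assumes "range f \<subseteq> carrier G"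
  obtains \<phi> where "\<phi> \<in> hom free_group G" "\<And>x. \<phi> (free_gen x) = f x"
proof
  define \<phi> where "\<phi> A = eval_word G f (SOME w. A = word_class w)" for A
  have \<phi>: "\<phi> (word_class w) = eval_word G f w" for w
  proof -
    have "word_class w = word_class (SOME v. word_class w = word_class v)"
      by (rule someI) (rule refl)
    then show ?thesis
      unfolding \<phi>_def by (metis (no_types) word_class_eq_iff eval_word_cancels assms)
  qed
  show "\<phi> \<in> hom free_group G"
    by (auto simp: hom_def carrier_free_group \<phi> mult_free_group eval_word_append eval_word_closed assms)
  show "\<phi> (free_gen x) = f x" for x
    using assms by (auto simp: free_gen_def \<phi> image_subset_iff)
qed

end

text \<open>
  The kernel of a homomorphism is normal, so as soon as it contains the relators it contains their
  normal closure, and the homomorphism factors through the quotient.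
\<close>

lemma presented_group_hom:
  assumes R: "R \<subseteq> carrier free_group \<times> carrier free_group"
    and M: "group M" and \<phi>: "\<phi> \<in> hom free_group M"
    and rel: "\<And>u v. (u, v) \<in> R \<Longrightarrow> \<phi> u = \<phi> v"
  obtains h where "h \<in> hom (presented_group R) M"
    "\<And>x. h (presented_gen R x) = \<phi> (free_gen x)"
proof -
  interpret group_hom free_group M \<phi>
    by (simp add: group_hom_def group_hom_axioms_def M \<phi> group_free_group)
  have "relation_subgroup R \<subseteq> kernel free_group M \<phi>"
    unfolding relation_subgroup_def normal_closure_def
  proof (rule Inf_lower, clarsimp simp: normal_kernel)
    fix u v assume uv: "(u, v) \<in> R"
    with R have "u \<in> carrier free_group" "v \<in> carrier free_group" by auto
    with rel[OF uv] show "u \<otimes>\<^bsub>free_group\<^esub> inv\<^bsub>free_group\<^esub> v \<in> kernel free_group M \<phi>"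
      by (simp add: kernel_def)
  qed
  from FactGroup_universal_kernel[OF relation_subgroup_normal[OF R] this]
  show thesis
    using that unfolding presented_group_def presented_gen_def by (metis free_gen_closed)
qed

lemma presented_projection:
  assumes "R \<subseteq> carrier free_group \<times> carrier free_group"
  obtains \<pi> where "group_hom free_group (presented_group R) \<pi>"
    "\<pi> ` carrier free_group = carrier (presented_group R)"
    "\<And>x. \<pi> (free_gen x) = presented_gen R x"
    "\<And>u v. (u, v) \<in> R \<Longrightarrow> \<pi> u = \<pi> v"
proof
  let ?\<pi> = "\<lambda>u. relation_subgroup R #>\<^bsub>free_group\<^esub> u"
  interpret N: normal "relation_subgroup R" free_group
    by (rule relation_subgroup_normal[OF assms])
  show "group_hom free_group (presented_group R) ?\<pi>"
    unfolding presented_group_def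
    by (simp add: group_hom_def group_hom_axioms_def N.r_coset_hom_Mod N.factorgroup_is_group
        group_free_group)
  show "?\<pi> ` carrier free_group = carrier (presented_group R)"
    unfolding presented_group_def carrier_FactGroup ..
  show "?\<pi> (free_gen x) = presented_gen R x" for x
    by (simp add: presented_gen_def)
  fix u v assume uv: "(u, v) \<in> R"
  with assms have c: "u \<in> carrier free_group" "v \<in> carrier free_group" by auto
  have "u \<otimes>\<^bsub>free_group\<^esub> inv\<^bsub>free_group\<^esub> v \<in> relation_subgroup R"
    unfolding relation_subgroup_def normal_closure_def using uv by blast
  then have "u \<in> ?\<pi> v"
    using c N.rcos_module_rev by auto
  then show "?\<pi> u = ?\<pi> v"
    using c N.repr_independence N.subgroup_axioms by simp
qed

lemma free_group_generated: "carrier free_group = generate free_group (range free_gen)"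
proof -
  interpret F: group "free_group" by (rule group_free_group)
  have sub: "range free_gen \<subseteq> carrier free_group"
    by (auto simp: free_gen_closed)
  interpret S: subgroup "generate free_group (range free_gen)" free_group
    by (rule F.generate_is_subgroup[OF sub])
  have "word_class w \<in> generate free_group (range free_gen)" for w :: "'a word"
  proof (induction w)
    case Nil
    then show ?case using S.one_closed by (simp add: one_free_group)
  next
    case (Cons l w)
    obtain x b where l: "l = (x, b)" by fastforce
    have "inv\<^bsub>free_group\<^esub> (word_class [(x, True)]) = word_class [(x, False)]"
    proof (rule F.inv_equality)
      have "cancels ([] @ [(x, False), (x, \<not> False)] @ []) ([] @ [])"
        by (rule cancels.intros)
      then show "word_class [(x, False)] \<otimes>\<^bsub>free_group\<^esub> word_class [(x, True)] = \<one>\<^bsub>free_group\<^esub>"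
        by (simp add: mult_free_group one_free_group word_class_eq_iff r_into_equivclp)
    qed (auto simp: carrier_free_group)
    moreover have "free_gen x \<in> generate free_group (range free_gen)"
      by (auto intro: generate.incl)
    ultimately have "word_class [l] \<in> generate free_group (range free_gen)"
      using S.m_inv_closed[of "free_gen x"] by (cases b) (auto simp: free_gen_def l)
    then show ?case
      using S.m_closed[OF _ Cons, of "word_class [l]"] by (simp add: mult_free_group)
  qed
  then show ?thesis
    using F.generate_incl[OF sub] by (auto simp: carrier_free_group)
qed

lemma presented_group_generated:
  assumes "R \<subseteq> carrier free_group \<times> carrier free_group"
  shows "carrier (presented_group R) = generate (presented_group R) (range (presented_gen R))"
proof -
  obtain \<pi> where \<pi>: "group_hom free_group (presented_group R) \<pi>"
    "\<pi> ` carrier free_group = carrier (presented_group R)"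
    "\<And>x. \<pi> (free_gen x) = presented_gen R x"
    using presented_projection[OF assms] by metis
  have "carrier (presented_group R) = \<pi> ` generate free_group (range free_gen)"
    using \<pi>(2) free_group_generated by metis
  also have "\<dots> = generate (presented_group R) (\<pi> ` range free_gen)"
    by (rule group_hom.generate_img[OF \<pi>(1), symmetric]) (auto simp: free_gen_closed)
  finally show ?thesis
    using \<pi>(3) by (simp add: image_image)
qed


section \<open>Recognising the type of an abelianization\<close>

text \<open>
  The map \<open>\<Phi>\<close> on integer vectors is additive, and \<open>indep\<close> identifies its kernel with
  \<open>a\<^sub>1\<int> \<times> \<dots> \<times> a\<^sub>r\<int>\<close>; restricted to reduced vectors it is thus an isomorphism from the product of cyclic
  groups.
\<close>

lemma (in comm_group) of_typeI:
  fixes x :: "nat \<Rightarrow> 'a" and as :: "nat list"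
  defines "\<Phi> \<equiv> \<lambda>f::nat \<Rightarrow> int. \<Otimes>k\<in>{..<length as}. x k [^] f k"
  assumes x: "\<And>k. k < length as \<Longrightarrow> x k \<in> carrier G"
    and pos: "\<And>k. k < length as \<Longrightarrow> 0 < as ! k"
    and gen: "carrier G \<subseteq> range \<Phi>"
    and indep: "\<And>f. \<Phi> f = \<one> \<longleftrightarrow> (\<forall>k<length as. int (as ! k) dvd f k)"
  shows "of_type G as"
proof -
  let ?P = "product_group {..<length as} (\<lambda>i. integer_mod_group (as ! i))"
  have closed: "\<Phi> f \<in> carrier G" for f
    unfolding \<Phi>_def using x by (auto intro!: finprod_closed)
  have carr: "carrier ?P = (\<Pi>\<^sub>E k\<in>{..<length as}. {0..<int (as ! k)})"
  proof -
    have "carrier (integer_mod_group (as ! k)) = {0..<int (as ! k)}" if "k \<in> {..<length as}" for k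
      using pos[of k] that by (simp add: carrier_integer_mod_group)
    then show ?thesis
      unfolding carrier_product_group by (rule PiE_cong)
  qed
  have add: "\<Phi> (\<lambda>k. f k + g k) = \<Phi> f \<otimes> \<Phi> g" for f g
  proof -
    have "(\<Otimes>k\<in>{..<length as}. x k [^] (f k + g k)) =
        (\<Otimes>k\<in>{..<length as}. x k [^] f k \<otimes> x k [^] g k)"
      using x by (intro finprod_cong') (auto simp: int_pow_mult)
    also have "\<dots> = \<Phi> f \<otimes> \<Phi> g"
      unfolding \<Phi>_def using x by (intro finprod_multf) auto
    finally show ?thesis unfolding \<Phi>_def .
  qed
  have eq: "\<Phi> f = \<Phi> g" if "\<And>k. k < length as \<Longrightarrow> int (as ! k) dvd f k - g k" for f g
  proof -
    have "\<Phi> (\<lambda>k. f k - g k) = \<one>"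
      unfolding indep using that by blast
    then show ?thesis
      using add[of "\<lambda>k. f k - g k" g] closed by simp
  qed
  have eqD: "int (as ! k) dvd f k - g k" if "\<Phi> f = \<Phi> g" "k < length as" for f g k
  proof -
    have "\<Phi> (\<lambda>k. f k - g k) \<otimes> \<Phi> g = \<one> \<otimes> \<Phi> g"
      using add[of "\<lambda>k. f k - g k" g] that closed by simp
    then have "\<Phi> (\<lambda>k. f k - g k) = \<one>"
      using closed r_cancel by blast
    then show ?thesis
      unfolding indep using that(2) by blast
  qed
  have hom: "\<Phi> \<in> hom ?P G"
  proof (rule homI)
    fix f g assume "f \<in> carrier ?P" "g \<in> carrier ?P"
    show "\<Phi> (f \<otimes>\<^bsub>?P\<^esub> g) = \<Phi> f \<otimes> \<Phi> g"
      unfolding add[symmetric] by (rule eq, subst mod_eq_dvd_iff[symmetric]) simp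
  qed (rule closed)
  moreover have "inj_on \<Phi> (carrier ?P)"
  proof (rule inj_onI)
    fix f g assume fg: "f \<in> carrier ?P" "g \<in> carrier ?P" "\<Phi> f = \<Phi> g"
    show "f = g"
    proof (rule PiE_ext)
      fix k assume k: "k \<in> {..<length as}"
      then have "f k mod int (as ! k) = g k mod int (as ! k)"
        using eqD[OF fg(3)] by (simp add: mod_eq_dvd_iff)
      moreover have "f k \<in> {0..<int (as ! k)}" "g k \<in> {0..<int (as ! k)}"
        using fg(1,2) k unfolding carr by (auto simp: PiE_iff)
      ultimately show "f k = g k" by simp
    qed (use fg carr in auto)
  qed
  moreover have "\<Phi> ` carrier ?P = carrier G"
  proof -
    have "\<Phi> f \<in> \<Phi> ` carrier ?P" for f
    proof (rule image_eqI)
      let ?g = "\<lambda>k\<in>{..<length as}. f k mod int (as ! k)"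
      show "\<Phi> f = \<Phi> ?g"
        by (rule eq, subst mod_eq_dvd_iff[symmetric]) simp
      show "?g \<in> carrier ?P"
        unfolding carr using pos by auto
    qed
    then have "range \<Phi> \<subseteq> \<Phi> ` carrier ?P"
      by (rule image_subsetI)
    moreover have "\<Phi> ` carrier ?P \<subseteq> carrier G"
      by (rule image_subsetI) (rule closed)
    ultimately show ?thesis using gen by (meson subset_antisym subset_trans)
  qed
  ultimately have iso: "\<Phi> \<in> iso ?P G"
    by (simp add: iso_def bij_betw_def)
  have "finite (carrier ?P)"
    unfolding carr by (intro finite_PiE) auto
  then have "finite (carrier G)"
    using bij_betw_finite[of \<Phi>] iso by (auto simp: iso_def)
  moreover have "?P \<cong> G"
    using iso by (rule is_isoI)
  then have "G \<cong> ?P"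
    by (rule group.iso_sym[rotated]) simp
  ultimately show ?thesis
    unfolding of_type_def using comm_group_axioms by blast
qed

text \<open>
  The previous criterion pulled back to representatives in \<open>H\<close>. The product is a \<open>foldr\<close> because
  \<open>H\<close> itself need not be commutative, so that the order of the factors has to be fixed.
\<close>

lemma (in group) of_type_abelianizationI:
  fixes xs :: "'a list" and as :: "nat list"
  assumes H: "subgroup H G" and xs: "set xs \<subseteq> H" "length xs = length as"
    and pos: "\<And>k. k < length as \<Longrightarrow> 0 < as ! k"
    and gen: "\<And>h. h \<in> H \<Longrightarrow>
       \<exists>f. \<exists>d\<in>derived G H. h = d \<otimes> foldr (\<lambda>k y. xs ! k [^] (f k :: int) \<otimes> y) [0..<length as] \<one>"
    and indep: "\<And>f. foldr (\<lambda>k y. xs ! k [^] (f k :: int) \<otimes> y) [0..<length as] \<one> \<in> derived G H \<longleftrightarrow>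
       (\<forall>k<length as. int (as ! k) dvd f k)"
  shows "of_type (abelianization G H) as"
proof -
  let ?H = "G\<lparr>carrier := H\<rparr>" and ?D = "derived G H"
  let ?w = "\<lambda>f. foldr (\<lambda>k y. xs ! k [^] (f k :: int) \<otimes> y) [0..<length as] \<one>"
  interpret H: subgroup H G by (rule H)
  interpret D: normal ?D ?H by (rule derived_subgroup_is_normal[OF H])
  interpret Q: comm_group "?H Mod ?D" by (rule derived_quot_of_subgroup_is_comm_group[OF H])
  interpret \<pi>: group_hom ?H "?H Mod ?D" "\<lambda>h. ?D #>\<^bsub>?H\<^esub> h"
    by (intro group_hom.intro group_hom_axioms.intro D.r_coset_hom_Mod Q.is_group D.is_group)
  have xk: "xs ! k \<in> H" if "k < length as" for k
    using xs that by (metis nth_mem subsetD)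
  have pw: "xs ! k [^] (i::int) \<in> H" if "k < length as" for k i
    using xk[OF that] H subgroup_int_pow_closed by blast
  \<comment> \<open>The trailing factor \<open>z\<close> makes the induction on the number of factors go through.\<close>
  have fin: "(\<Otimes>\<^bsub>?H Mod ?D\<^esub>k\<in>{..<m}. (?D #>\<^bsub>?H\<^esub> xs ! k) [^]\<^bsub>?H Mod ?D\<^esub> f k) \<otimes>\<^bsub>?H Mod ?D\<^esub> (?D #>\<^bsub>?H\<^esub> z)
      = ?D #>\<^bsub>?H\<^esub> foldr (\<lambda>k y. xs ! k [^] (f k :: int) \<otimes> y) [0..<m] z" 
      if "m \<le> length as" "z \<in> H" for f m z
    using that
  proof (induction m arbitrary: z)
    case 0
    then have "?D #>\<^bsub>?H\<^esub> z \<in> carrier (?H Mod ?D)"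
      using \<pi>.hom_closed[of z] by simp
    from Q.l_one[OF this] show ?case by (simp del: mult_FactGroup one_FactGroup)
  next
    case (Suc m)
    have P: "(\<lambda>k. (?D #>\<^bsub>?H\<^esub> xs ! k) [^]\<^bsub>?H Mod ?D\<^esub> f k) \<in> {..<m} \<rightarrow> carrier (?H Mod ?D)"
      using Suc.prems xk \<pi>.hom_closed by (auto intro!: Q.int_pow_closed)
    have xm: "xs ! m \<in> H" "xs ! m [^] f m \<in> H" using xk pw Suc.prems by auto
    have pm: "(?D #>\<^bsub>?H\<^esub> xs ! m) [^]\<^bsub>?H Mod ?D\<^esub> f m = ?D #>\<^bsub>?H\<^esub> (xs ! m [^] f m)"
      using \<pi>.hom_int_pow[of "xs ! m" "f m"] xm H by (simp add: int_pow_consistent)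
    have zm: "xs ! m [^] f m \<otimes> z \<in> H" using xm Suc.prems by auto
    let ?prod = "\<lambda>m. \<Otimes>\<^bsub>?H Mod ?D\<^esub>k\<in>{..<m}. (?D #>\<^bsub>?H\<^esub> xs ! k) [^]\<^bsub>?H Mod ?D\<^esub> f k"
    have c: "?D #>\<^bsub>?H\<^esub> z \<in> carrier (?H Mod ?D)" "?D #>\<^bsub>?H\<^esub> (xs ! m [^] f m) \<in> carrier (?H Mod ?D)"
      "?prod m \<in> carrier (?H Mod ?D)"
      using \<pi>.hom_closed Suc.prems xm Q.finprod_closed[OF P] by auto
    have "?prod (Suc m) = (?D #>\<^bsub>?H\<^esub> (xs ! m [^] f m)) \<otimes>\<^bsub>?H Mod ?D\<^esub> ?prod m"
      unfolding lessThan_Suc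
      by (subst Q.finprod_insert) (use P pm c(2) in \<open>simp_all del: mult_FactGroup\<close>)
    then have "?prod (Suc m) \<otimes>\<^bsub>?H Mod ?D\<^esub> (?D #>\<^bsub>?H\<^esub> z)
      = ?prod m \<otimes>\<^bsub>?H Mod ?D\<^esub> ((?D #>\<^bsub>?H\<^esub> (xs ! m [^] f m)) \<otimes>\<^bsub>?H Mod ?D\<^esub> (?D #>\<^bsub>?H\<^esub> z))"
      using Q.m_comm[OF c(2,3)] Q.m_assoc[OF c(3,2,1)] by presburger
    also have "\<dots> = ?prod m \<otimes>\<^bsub>?H Mod ?D\<^esub> (?D #>\<^bsub>?H\<^esub> (xs ! m [^] f m \<otimes> z))"
      using \<pi>.hom_mult[of "xs ! m [^] f m" z] xm Suc.prems by simp
    also have "\<dots> = ?D #>\<^bsub>?H\<^esub> foldr (\<lambda>k y. xs ! k [^] f k \<otimes> y) [0..<m] (xs ! m [^] f m \<otimes> z)"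
      by (rule Suc.IH[OF Suc_leD[OF Suc.prems(1)] zm])
    finally show ?case by simp
  qed
  have wH: "?w f \<in> H" for f
  proof -
    have "foldr (\<lambda>k y. xs ! k [^] (f k :: int) \<otimes> y) ks \<one> \<in> H" if "set ks \<subseteq> {..<length as}" for ks
      using that by (induction ks) (auto simp: pw)
    from this[of "[0..<length as]"] show ?thesis by fastforce
  qed
  have fin': "(\<Otimes>\<^bsub>?H Mod ?D\<^esub>k\<in>{..<length as}. (?D #>\<^bsub>?H\<^esub> xs ! k) [^]\<^bsub>?H Mod ?D\<^esub> f k) = ?D #>\<^bsub>?H\<^esub> ?w f" for f
  proof -
    have P: "(\<lambda>k. (?D #>\<^bsub>?H\<^esub> xs ! k) [^]\<^bsub>?H Mod ?D\<^esub> f k) \<in> {..<length as} \<rightarrow> carrier (?H Mod ?D)"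
      using xk \<pi>.hom_closed by (auto intro!: Q.int_pow_closed)
    have one: "?D #>\<^bsub>?H\<^esub> \<one> = \<one>\<^bsub>?H Mod ?D\<^esub>"
      using \<pi>.hom_one by simp
    have "(\<Otimes>\<^bsub>?H Mod ?D\<^esub>k\<in>{..<length as}. (?D #>\<^bsub>?H\<^esub> xs ! k) [^]\<^bsub>?H Mod ?D\<^esub> f k) =
       (\<Otimes>\<^bsub>?H Mod ?D\<^esub>k\<in>{..<length as}. (?D #>\<^bsub>?H\<^esub> xs ! k) [^]\<^bsub>?H Mod ?D\<^esub> f k) \<otimes>\<^bsub>?H Mod ?D\<^esub> (?D #>\<^bsub>?H\<^esub> \<one>)"
      unfolding one by (rule Q.r_one[OF Q.finprod_closed[OF P], symmetric])
    also have "\<dots> = ?D #>\<^bsub>?H\<^esub> ?w f"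
      by (rule fin) simp_all
    finally show ?thesis .
  qed
  show ?thesis
    unfolding abelianization_def
  proof (rule Q.of_typeI[of as "\<lambda>k. ?D #>\<^bsub>?H\<^esub> xs ! k"], unfold fin')
    show "?D #>\<^bsub>?H\<^esub> xs ! k \<in> carrier (?H Mod ?D)" if "k < length as" for k
      using \<pi>.hom_closed xk[OF that] by simp
    show "carrier (?H Mod ?D) \<subseteq> range (\<lambda>f. ?D #>\<^bsub>?H\<^esub> ?w f)"
    proof
      fix Y assume "Y \<in> carrier (?H Mod ?D)"
      then obtain h where h: "h \<in> H" "Y = ?D #>\<^bsub>?H\<^esub> h"
        by (auto simp: carrier_FactGroup)
      then obtain f d where d: "d \<in> ?D" "h = d \<otimes> ?w f"
        using gen[OF h(1)] by auto
      have "h \<in> ?D #>\<^bsub>?H\<^esub> ?w f"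
        using d by (auto simp: r_coset_def)
      then have "?D #>\<^bsub>?H\<^esub> ?w f = Y"
        using D.repr_independence[of h "?D" "?w f"] wH[of f] D.subgroup_axioms h by simp
      then show "Y \<in> range (\<lambda>f. ?D #>\<^bsub>?H\<^esub> ?w f)" by blast
    qed
    show "(?D #>\<^bsub>?H\<^esub> ?w f = \<one>\<^bsub>?H Mod ?D\<^esub>) \<longleftrightarrow> (\<forall>k<length as. int (as ! k) dvd f k)" for f
    proof -
      have "?w f \<in> carrier ?H" using wH by simp
      then have "?D #>\<^bsub>?H\<^esub> ?w f = ?D \<longleftrightarrow> ?w f \<in> ?D"
        using D.coset_join1[OF _ _ D.subgroup_axioms] D.coset_join2[OF _ D.subgroup_axioms]
        by blast
      then show ?thesis
        unfolding one_FactGroup by (rule trans) (rule indep)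
    qed
  qed (use pos in auto)
qed

context group
begin

lemma of_type_pairI:
  fixes p q :: nat
  assumes H: "subgroup H G" and xy: "x \<in> H" "y \<in> H" and pos: "0 < p" "0 < q"
    and gen: "\<And>h. h \<in> H \<Longrightarrow> \<exists>(i::int) (j::int). \<exists>d\<in>derived G H. h = d \<otimes> (x [^] i \<otimes> y [^] j)"
    and indep: "\<And>(i::int) (j::int). x [^] i \<otimes> y [^] j \<in> derived G H \<longleftrightarrow> int p dvd i \<and> int q dvd j"
  shows "of_type (abelianization G H) [p, q]"
proof (rule of_type_abelianizationI[OF H, of "[x, y]"])
  have [simp]: "x \<in> carrier G" "y \<in> carrier G"
    using subgroup.subset[OF H] xy by auto
  have w: "foldr (\<lambda>k z. [x, y] ! k [^] (f k :: int) \<otimes> z) [0..<length [p, q]] \<one> = x [^] f 0 \<otimes> y [^] f 1" for f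
    by (simp add: upt_rec)
  show "\<exists>f. \<exists>d\<in>derived G H. h = d \<otimes> foldr (\<lambda>k z. [x, y] ! k [^] (f k :: int) \<otimes> z) [0..<length [p, q]] \<one>"
    if h: "h \<in> H" for h
  proof -
    obtain i j d where "d \<in> derived G H" "h = d \<otimes> (x [^] (i::int) \<otimes> y [^] (j::int))"
      using gen[OF h] by blast
    then show ?thesis
      unfolding w by (intro exI[of _ "\<lambda>k. if k = 0 then i else j"]) auto
  qed
  show "(foldr (\<lambda>k z. [x, y] ! k [^] (f k :: int) \<otimes> z) [0..<length [p, q]] \<one> \<in> derived G H) =
      (\<forall>k<length [p, q]. int ([p, q] ! k) dvd f k)" for f
    unfolding w indep by (auto simp: less_Suc_eq)
qed (use xy pos in \<open>auto simp: less_Suc_eq\<close>)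

lemma of_type_tripleI:
  fixes p q m :: nat
  assumes H: "subgroup H G" and xyz: "x \<in> H" "y \<in> H" "z \<in> H" and pos: "0 < p" "0 < q" "0 < m"
    and gen: "\<And>h. h \<in> H \<Longrightarrow>
      \<exists>(i::int) (j::int) (k::int). \<exists>d\<in>derived G H. h = d \<otimes> (x [^] i \<otimes> (y [^] j \<otimes> z [^] k))"
    and indep: "\<And>(i::int) (j::int) (k::int). x [^] i \<otimes> (y [^] j \<otimes> z [^] k) \<in> derived G H \<longleftrightarrow>
      int p dvd i \<and> int q dvd j \<and> int m dvd k"
  shows "of_type (abelianization G H) [p, q, m]"
proof (rule of_type_abelianizationI[OF H, of "[x, y, z]"])
  have [simp]: "x \<in> carrier G" "y \<in> carrier G" "z \<in> carrier G"
    using subgroup.subset[OF H] xyz by auto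
  have w: "foldr (\<lambda>k u. [x, y, z] ! k [^] (f k :: int) \<otimes> u) [0..<length [p, q, m]] \<one>
      = x [^] f 0 \<otimes> (y [^] f 1 \<otimes> z [^] f 2)" for f
    by (simp add: upt_rec numeral_2_eq_2)
  show "\<exists>f. \<exists>d\<in>derived G H. h = d \<otimes> foldr (\<lambda>k u. [x, y, z] ! k [^] (f k :: int) \<otimes> u) [0..<length [p, q, m]] \<one>"
    if h: "h \<in> H" for h
  proof -
    obtain i j k d where "d \<in> derived G H" "h = d \<otimes> (x [^] (i::int) \<otimes> (y [^] (j::int) \<otimes> z [^] (k::int)))"
      using gen[OF h] by blast
    then show ?thesis
      unfolding w by (intro exI[of _ "\<lambda>l. if l = 0 then i else if l = 1 then j else k"]) auto
  qed
  show "(foldr (\<lambda>k u. [x, y, z] ! k [^] (f k :: int) \<otimes> u) [0..<length [p, q, m]] \<one> \<in> derived G H) =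
      (\<forall>k<length [p, q, m]. int ([p, q, m] ! k) dvd f k)" for f
    unfolding w indep by (auto simp: less_Suc_eq numeral_2_eq_2)
qed (use xyz pos in \<open>auto simp: less_Suc_eq numeral_2_eq_2\<close>)

end


section \<open>Subgroups of index two and derived subgroups\<close>

context group
begin

text \<open>
  The preimage of 0 under a homomorphism to \<open>\<int>/2\<close>, described without mentioning the homomorphism. The whole
  group is included, as the preimage under the trivial one.
\<close>

definition parity_set :: "'a set \<Rightarrow> bool" where
  "parity_set K \<longleftrightarrow> K \<subseteq> carrier G \<and>
     (\<forall>x\<in>carrier G. \<forall>y\<in>carrier G. x \<otimes> y \<in> K \<longleftrightarrow> (x \<in> K \<longleftrightarrow> y \<in> K))"

lemma parity_set_mult:
  "parity_set K \<Longrightarrow> x \<in> carrier G \<Longrightarrow> y \<in> carrier G \<Longrightarrow> x \<otimes> y \<in> K \<longleftrightarrow> (x \<in> K \<longleftrightarrow> y \<in> K)"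
  unfolding parity_set_def by blast

lemma parity_set_one: "parity_set K \<Longrightarrow> \<one> \<in> K"
  using parity_set_mult[of K \<one> \<one>] by simp

lemma parity_set_inv: "parity_set K \<Longrightarrow> x \<in> carrier G \<Longrightarrow> inv x \<in> K \<longleftrightarrow> x \<in> K"
  using parity_set_mult[of K x "inv x"] parity_set_one[of K] by simp

lemma parity_set_subgroup:
  assumes K: "parity_set K"
  shows "subgroup K G"
proof -
  have "K \<subseteq> carrier G" using K by (simp add: parity_set_def)
  with K show ?thesis
    by (intro subgroup.intro) (auto simp: parity_set_mult parity_set_one parity_set_inv subset_iff)
qed

text \<open>
  If \<open>K\<close> has index two, then all elements outside \<open>K\<close> lie in one coset, so \<open>x, y \<notin> K\<close> gives
  \<open>Kx = Ky\<inverse>\<close> and hence \<open>xy \<in> K\<close>. Conversely, for a proper parity set the cosets are \<open>K\<close> and its complement.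
\<close>

lemma index_2_iff_parity_set:
  "subgroup K G \<and> card (rcosets K) = 2 \<longleftrightarrow> parity_set K \<and> K \<noteq> carrier G"
proof
  assume K: "subgroup K G \<and> card (rcosets K) = 2"
  interpret K: subgroup K G using K by blast
  have K0: "K \<in> rcosets K"
    using K.subgroup_in_rcosets is_group by blast
  have cos: "K #> x = K \<longleftrightarrow> x \<in> K" if "x \<in> carrier G" for x
    using coset_join1[OF _ that] coset_join2[OF that] K by blast
  have same: "K #> x = K #> y" if "x \<in> carrier G - K" "y \<in> carrier G - K" for x y
  proof -
    have "K #> x \<in> rcosets K" "K #> y \<in> rcosets K"
      using that rcosetsI K.subset by auto
    moreover have "K #> x \<noteq> K" "K #> y \<noteq> K" using cos that by auto
    moreover obtain A B where "rcosets K = {A, B}"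
      using K by (auto simp: card_2_iff)
    ultimately show ?thesis
      using K0 by (metis insertE singletonD)
  qed
  have "x \<otimes> y \<in> K \<longleftrightarrow> (x \<in> K \<longleftrightarrow> y \<in> K)" if xy: "x \<in> carrier G" "y \<in> carrier G" for x y
  proof (cases "x \<in> K")
    case True
    have "y \<in> K" if "x \<otimes> y \<in> K"
      using K.m_closed[OF K.m_inv_closed[OF True] that] xy by (simp add: m_assoc[symmetric])
    with True show ?thesis by auto
  next
    case False
    have "x \<in> K" if "x \<otimes> y \<in> K" "y \<in> K"
      using K.m_closed[OF that(1) K.m_inv_closed[OF that(2)]] xy by (simp add: m_assoc)
    moreover have "x \<otimes> y \<in> K" if "y \<notin> K"
    proof -
      have "inv y \<notin> K" using K.m_inv_closed[of "inv y"] that xy by auto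
      with same[of x "inv y"] False xy have "K #> x = K #> inv y" by simp
      then have "x \<in> K #> inv y" using rcos_self[OF xy(1) K.subgroup_axioms] by simp
      then obtain k where "k \<in> K" "x = k \<otimes> inv y" by (auto simp: r_coset_def)
      then show ?thesis using xy K.mem_carrier[of k] by (simp add: m_assoc)
    qed
    ultimately show ?thesis using False by blast
  qed
  then have "parity_set K"
    unfolding parity_set_def using K.subset by blast
  moreover have "K \<noteq> carrier G"
  proof
    assume eq: "K = carrier G"
    have "rcosets K \<subseteq> {K}"
      using cos by (auto simp: RCOSETS_def) (simp_all add: eq)
    then have "card (rcosets K) \<le> card {K}"
      by (intro card_mono) auto
    with K show False by simp
  qed
  ultimately show "parity_set K \<and> K \<noteq> carrier G" by blast
next
  assume K: "parity_set K \<and> K \<noteq> carrier G"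
  then have sub: "subgroup K G" by (simp add: parity_set_subgroup)
  interpret K: subgroup K G by (rule sub)
  have 1: "K #> x = K" if "x \<in> K" for x
    using that sub by (simp add: coset_join2 K.mem_carrier)
  have 2: "K #> x = carrier G - K" if x: "x \<in> carrier G" "x \<notin> K" for x
  proof (intro equalityI subsetI)
    fix y assume "y \<in> K #> x"
    then show "y \<in> carrier G - K"
      using K x K.mem_carrier by (auto simp: r_coset_def parity_set_mult)
  next
    fix y assume y: "y \<in> carrier G - K"
    then have "y \<otimes> inv x \<in> K" using K x by (simp add: parity_set_mult parity_set_inv)
    moreover have "y = (y \<otimes> inv x) \<otimes> x" using x y by (simp add: m_assoc)
    ultimately show "y \<in> K #> x" unfolding r_coset_def by blast
  qed
  obtain g where g: "g \<in> carrier G" "g \<notin> K" using K K.subset by blast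
  have "rcosets K = {K, carrier G - K}"
  proof (intro equalityI subsetI)
    fix A assume "A \<in> rcosets K"
    then obtain x where "x \<in> carrier G" "A = K #> x" by (auto simp: RCOSETS_def)
    then show "A \<in> {K, carrier G - K}" using 1 2 by (cases "x \<in> K") simp_all
  next
    fix A assume "A \<in> {K, carrier G - K}"
    then have "A = K #> \<one> \<or> A = K #> g" using 1[OF K.one_closed] 2[OF g] by simp
    then show "A \<in> rcosets K" using g rcosetsI[OF K.subset] by auto
  qed
  moreover have "K \<noteq> carrier G - K" using K.one_closed by blast
  ultimately show "subgroup K G \<and> card (rcosets K) = 2"
    using sub by simp
qed

lemma parity_set_eqI:
  assumes K: "parity_set K" and L: "parity_set L"
    and S: "carrier G = generate G S" "S \<subseteq> carrier G"
    and eq: "\<And>x. x \<in> S \<Longrightarrow> x \<in> K \<longleftrightarrow> x \<in> L"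
  shows "K = L"
proof -
  have "x \<in> K \<longleftrightarrow> x \<in> L" if "x \<in> generate G S" for x
    using that
  proof (induction rule: generate.induct)
    case one
    then show ?case using K L by (simp add: parity_set_one)
  next
    case (incl h)
    then show ?case by (rule eq)
  next
    case (inv h)
    with S(2) eq[of h] show ?case using K L by (auto simp: parity_set_inv)
  next
    case (eng h1 h2)
    then have "h1 \<in> carrier G" "h2 \<in> carrier G" by (simp_all only: S(1))
    with eng.IH show ?case using K L by (simp add: parity_set_mult)
  qed
  moreover have "K \<subseteq> generate G S" "L \<subseteq> generate G S"
    using K L unfolding parity_set_def S(1)[symmetric] by simp_all
  ultimately show ?thesis by blast
qed

text \<open>
  The hypothesis bounds the commutators \<open>x y x\<inverse> y\<inverse>\<close> only; being a subgroup, \<open>D\<close> then contains everything they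
  generate.
\<close>

lemma derived_subsetI:
  assumes H: "H \<subseteq> carrier G" and D: "subgroup D G"
    and comm: "\<And>x y. x \<in> H \<Longrightarrow> y \<in> H \<Longrightarrow> \<exists>d\<in>D. x \<otimes> y = d \<otimes> (y \<otimes> x)"
  shows "derived G H \<subseteq> D"
  unfolding derived_def
proof (rule generate_subgroup_incl[OF _ D], clarify)
  fix x y assume xy: "x \<in> H" "y \<in> H"
  then obtain d where d: "d \<in> D" "x \<otimes> y = d \<otimes> (y \<otimes> x)" using comm by blast
  have "x \<in> carrier G" "y \<in> carrier G" "d \<in> carrier G"
    using xy H d subgroup.subset[OF D] by auto
  then have "x \<otimes> y \<otimes> inv x \<otimes> inv y = d \<otimes> (y \<otimes> (x \<otimes> inv x)) \<otimes> inv y"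
    unfolding d(2) by (simp only: m_assoc m_closed inv_closed)
  also have "\<dots> = d"
    using \<open>x \<in> carrier G\<close> \<open>y \<in> carrier G\<close> \<open>d \<in> carrier G\<close> by (simp add: m_assoc)
  finally have "x \<otimes> y \<otimes> inv x \<otimes> inv y = d" .
  then show "x \<otimes> y \<otimes> inv x \<otimes> inv y \<in> D" using d by simp
qed

end


section \<open>Normal forms\<close>

lemma (in group) int_pow_intertwine:
  assumes "x \<in> carrier G" "y \<in> carrier G" "z \<in> carrier G" "x \<otimes> y = z \<otimes> x"
  shows "x \<otimes> y [^] (a::int) = z [^] a \<otimes> x"
proof -
  have nat: "x \<otimes> y [^] k = z [^] k \<otimes> x" for k :: nat
  proof (induction k)
    case (Suc k)
    have "x \<otimes> y [^] Suc k = (x \<otimes> y [^] k) \<otimes> y"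
      using assms by (simp add: m_assoc)
    also have "\<dots> = z [^] k \<otimes> (x \<otimes> y)"
      unfolding Suc using assms by (simp add: m_assoc)
    also have "\<dots> = z [^] Suc k \<otimes> x"
      unfolding assms(4) using assms by (simp add: m_assoc)
    finally show ?case .
  qed (use assms in simp)
  show ?thesis
  proof (cases a rule: int_cases2)
    case (nonneg k)
    then show ?thesis using nat by (simp add: int_pow_int)
  next
    case (nonpos k)
    have "inv (z [^] k) \<otimes> x = inv (z [^] k) \<otimes> (x \<otimes> y [^] k) \<otimes> inv (y [^] k)"
      using assms(1-3) by (simp add: m_assoc)
    also have "\<dots> = x \<otimes> inv (y [^] k)"
      unfolding nat using assms(1-3) by (simp add: m_assoc[symmetric])
    finally show ?thesis
      using assms(1-3) nonpos by (simp add: int_pow_neg_int)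
  qed
qed

text \<open>
  A group with generators that satisfy the relations of \<open>G\<^sub>n\<close> and no others; the comments write
  \<open>\<sigma>, \<tau>, \<rho>\<close> for \<open>s, t, r\<close>. The relations involving \<open>\<rho>\<close> are put in
  the form of commutation rules that move \<open>\<rho>\<close> to the right, and the absence of further relations is
  reduced to what is needed to compare normal forms: the last two assumptions concern the intersection
  of the relations with \<open>\<langle>\<sigma>, \<tau>\<rangle>\<close> and the position of \<open>\<rho>\<close> outside it. The generators are parameters so that the
  results can also be applied to other triples of generators of the same group.
\<close>

locale Gn_group = group G for G (structure) +
  fixes n :: nat and s t r :: 'a
  assumes n: "1 \<le> n"
    and s [simp]: "s \<in> carrier G" and t [simp]: "t \<in> carrier G" and r [simp]: "r \<in> carrier G"
    and generated: "carrier G = generate G {s, t, r}"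
    and s4: "s [^] (4::int) = t [^] ((2::int) ^ (n + 1))"
    and s8: "s [^] (8::int) = \<one>"
    and r2: "r [^] (2::int) = t [^] ((2::int) ^ n) \<otimes> s [^] (2::int)"
    and ts: "t \<otimes> s = s \<otimes> t"
    and rs: "r \<otimes> s = s [^] (3::int) \<otimes> r"
    and rt: "r \<otimes> t = t [^] (-1::int) \<otimes> r"
    and faithful: "\<And>(a::int) (b::int). s [^] a \<otimes> t [^] b = \<one> \<Longrightarrow>
      \<exists>j. b = 2 ^ (n + 1) * j \<and> 8 dvd a - 4 * j"
    and r_notin: "\<And>(a::int) (b::int). r \<noteq> s [^] a \<otimes> t [^] b"
begin

definition nf :: "int \<Rightarrow> int \<Rightarrow> int \<Rightarrow> 'a" where
  "nf a b c = s [^] a \<otimes> (t [^] b \<otimes> r [^] c)"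

lemma nf_closed [simp]: "nf a b c \<in> carrier G"
  by (simp add: nf_def)

lemma t_s_pow: "t [^] (b::int) \<otimes> s [^] (a::int) = s [^] a \<otimes> t [^] b"
proof -
  have "s \<otimes> t [^] b = t [^] b \<otimes> s"
    by (rule int_pow_intertwine) (simp_all add: ts)
  then show ?thesis
    by (intro int_pow_intertwine) simp_all
qed

text \<open>
  Conjugation by \<open>\<rho>\<close> cubes \<open>\<sigma>\<close>, so conjugation by \<open>\<rho>\<^sup>2\<close> raises it to the ninth power, which is \<open>\<sigma>\<close> again.
\<close>

lemma r_s_pow: "r [^] (c::int) \<otimes> s [^] (a::int) = s [^] ((if even c then 1 else 3) * a) \<otimes> r [^] c"
proof -
  have 1: "r \<otimes> s [^] a = s [^] (3 * a) \<otimes> r" for a :: int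
    using int_pow_intertwine[OF r s _ rs, of a] by (simp add: int_pow_pow)
  have s9: "s [^] (9::int) = s"
    using int_pow_mult[OF s, of 8 1] by (simp add: s8)
  have "r [^] (2::int) = r \<otimes> r"
    using int_pow_mult[OF r, of 1 1] by simp
  then have "r [^] (2::int) \<otimes> s = s \<otimes> r [^] (2::int)"
    using 1[of 1] 1[of 3] by (simp add: m_assoc s9) (simp add: m_assoc[symmetric] s9)
  then have "s \<otimes> r [^] (2 * k) = r [^] (2 * k) \<otimes> s" for k :: int
    using int_pow_intertwine[of s "r [^] (2::int)" "r [^] (2::int)" k] by (simp add: int_pow_pow mult.commute)
  then have 2: "r [^] (2 * k) \<otimes> s [^] a = s [^] a \<otimes> r [^] (2 * k)" for k a :: int
    by (intro int_pow_intertwine) simp_all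
  show ?thesis
  proof (cases "even c")
    case True
    then show ?thesis using 2 by (auto elim!: evenE)
  next
    case False
    then obtain k where k: "c = 2 * k + 1" by (rule oddE)
    have "r [^] c \<otimes> s [^] a = r [^] (2 * k) \<otimes> (r \<otimes> s [^] a)"
      unfolding k by (simp add: int_pow_mult m_assoc)
    also have "\<dots> = r [^] (2 * k) \<otimes> s [^] (3 * a) \<otimes> r"
      unfolding 1 by (simp add: m_assoc)
    also have "\<dots> = s [^] (3 * a) \<otimes> r [^] c"
      unfolding 2 k by (simp add: int_pow_mult m_assoc)
    finally show ?thesis using False by simp
  qed
qed

lemma r_t_pow: "r [^] (c::int) \<otimes> t [^] (b::int) = t [^] ((if even c then 1 else -1) * b) \<otimes> r [^] c"
proof -
  have 1: "r \<otimes> t [^] b = t [^] (- b) \<otimes> r" for b :: int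
    using int_pow_intertwine[OF r t _ rt, of b] by (simp add: int_pow_pow)
  have "r [^] (2::int) = r \<otimes> r"
    using int_pow_mult[OF r, of 1 1] by simp
  then have "r [^] (2::int) \<otimes> t = t \<otimes> r [^] (2::int)"
    using 1[of 1] 1[of "-1"] by (simp add: m_assoc) (simp add: m_assoc[symmetric])
  then have "t \<otimes> r [^] (2 * k) = r [^] (2 * k) \<otimes> t" for k :: int
    using int_pow_intertwine[of t "r [^] (2::int)" "r [^] (2::int)" k] by (simp add: int_pow_pow mult.commute)
  then have 2: "r [^] (2 * k) \<otimes> t [^] a = t [^] a \<otimes> r [^] (2 * k)" for k a :: int
    by (intro int_pow_intertwine) simp_all
  show ?thesis
  proof (cases "even c")
    case True
    then show ?thesis using 2 by (auto elim!: evenE)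
  next
    case False
    then obtain k where k: "c = 2 * k + 1" by (rule oddE)
    have "r [^] c \<otimes> t [^] b = r [^] (2 * k) \<otimes> (r \<otimes> t [^] b)"
      unfolding k by (simp add: int_pow_mult m_assoc)
    also have "\<dots> = r [^] (2 * k) \<otimes> t [^] (- b) \<otimes> r"
      unfolding 1 by (simp add: m_assoc)
    also have "\<dots> = t [^] (- b) \<otimes> r [^] c"
      unfolding 2 k by (simp add: int_pow_mult m_assoc)
    finally show ?thesis using False by simp
  qed
qed

lemma nf_mult: "nf a b c \<otimes> nf a' b' c' =
  nf (a + (if even c then 1 else 3) * a') (b + (if even c then 1 else -1) * b') (c + c')"
proof -
  define e f where "e = (if even c then 1 else 3) * a'" and "f = (if even c then 1 else -1) * b'"
  have "nf a b c \<otimes> nf a' b' c' = s [^] a \<otimes> (t [^] b \<otimes> ((r [^] c \<otimes> s [^] a') \<otimes> (t [^] b' \<otimes> r [^] c')))"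
    unfolding nf_def by (simp add: m_assoc)
  also have "\<dots> = s [^] a \<otimes> ((t [^] b \<otimes> s [^] e) \<otimes> ((r [^] c \<otimes> t [^] b') \<otimes> r [^] c'))"
    unfolding r_s_pow e_def[symmetric] by (simp add: m_assoc)
  also have "\<dots> = nf (a + e) (b + f) (c + c')"
    unfolding r_t_pow f_def[symmetric] t_s_pow by (simp add: nf_def m_assoc int_pow_mult)
  finally show ?thesis unfolding e_def f_def .
qed

lemma nf_s: "nf 1 0 0 = s" and nf_t: "nf 0 1 0 = t" and nf_r: "nf 0 0 1 = r" and nf_one: "nf 0 0 0 = \<one>"
  by (simp_all add: nf_def)

lemma s_pow_nf: "s [^] (a::int) = nf a 0 0" and t_pow_nf: "t [^] (a::int) = nf 0 a 0" and r_pow_nf: "r [^] (a::int) = nf 0 0 a" 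
  by (simp_all add: nf_def)

lemma nf_pow: "nf a b 0 [^] (k::int) = nf (k * a) (k * b) 0"
  unfolding nf_def using int_pow_mult_distrib[of "s [^] a" "t [^] b" k]
  by (simp add: int_pow_pow mult.commute t_s_pow)

lemma r_even_pow: "r [^] (2 * k :: int) = nf (2 * k) (2 ^ n * k) 0"
proof -
  have "r [^] (2 * k) = (r [^] (2::int)) [^] k" by (simp add: int_pow_pow)
  also have "r [^] (2::int) = nf 2 (2 ^ n) 0" by (simp add: r2 nf_def t_s_pow)
  finally show ?thesis by (simp add: nf_pow mult.commute)
qed

text \<open>
  Even powers of \<open>\<rho>\<close> lie in \<open>\<langle>\<sigma>, \<tau>\<rangle>\<close>, because \<open>\<rho>\<^sup>2 = \<tau>\<^bsup>2^n\<^esup> \<sigma>\<^sup>2\<close>. Normal forms are therefore not unique; this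
  rule accounts for all the ambiguity that involves \<open>\<rho>\<close>.
\<close>

lemma nf_even: "nf a b (2 * k) = nf (a + 2 * k) (b + 2 ^ n * k) 0"
proof -
  have "nf a b (2 * k) = nf a b 0 \<otimes> r [^] (2 * k :: int)"
    unfolding nf_def by (simp add: m_assoc)
  then show ?thesis by (simp add: r_even_pow nf_mult)
qed

lemma nf_eq_one: "nf a b 0 = \<one> \<longleftrightarrow> (\<exists>j. b = 2 ^ (n + 1) * j \<and> 8 dvd a - 4 * j)"
proof
  assume "nf a b 0 = \<one>"
  then show "\<exists>j. b = 2 ^ (n + 1) * j \<and> 8 dvd a - 4 * j"
    using faithful by (simp add: nf_def)
next
  assume "\<exists>j. b = 2 ^ (n + 1) * j \<and> 8 dvd a - 4 * j"
  then obtain j i where b: "b = 2 ^ (n + 1) * j" and a: "a = 4 * j + 8 * i" 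
    by (metis dvdE diff_eq_eq add.commute)
  have "t [^] b = s [^] (4 * j)"
    unfolding b using s4 by (metis int_pow_pow s t)
  moreover have "s [^] (8 * i) = \<one>"
    using s8 by (metis int_pow_pow int_pow_one s)
  moreover have "s [^] (8 * j) = \<one>"
    using s8 by (metis int_pow_pow int_pow_one s)
  ultimately show "nf a b 0 = \<one>"
    unfolding a nf_def by (simp add: int_pow_mult m_assoc) (simp flip: int_pow_mult)
qed

text \<open>
  Equality of normal forms forces \<open>c - c'\<close> to be even, since otherwise an odd power of \<open>\<rho>\<close>, and with it
  \<open>\<rho>\<close>, would lie in \<open>\<langle>\<sigma>, \<tau>\<rangle>\<close>. The remaining quotient lies in \<open>\<langle>\<sigma>, \<tau>\<rangle>\<close>, where triviality is known.
\<close>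

lemma nf_eqD:
  assumes eq: "nf a b c = nf a' b' c'"
  obtains j k where "c - c' = 2 * k" "b - b' + 2 ^ n * k = 2 ^ (n + 1) * j"
    "8 dvd a - a' + 2 * k - 4 * j"
proof -
  have "even (c - c')"
  proof (rule ccontr)
    assume "odd (c - c')"
    then have "even (c' + (1 - c))" by presburger
    then obtain k where k: "c' + (1 - c) = 2 * k" by (rule evenE)
    have "nf (-a) (-b) 0 \<otimes> nf a b c \<otimes> nf 0 0 (1 - c) = r"
      by (simp add: nf_mult nf_r)
    moreover have "nf (-a) (-b) 0 \<otimes> nf a' b' c' \<otimes> nf 0 0 (1 - c) = nf (a' - a) (b' - b) (2 * k)"
      unfolding k[symmetric] by (simp add: nf_mult)
    ultimately have "r = nf (a' - a) (b' - b) (2 * k)"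
      unfolding eq by simp
    then show False
      unfolding nf_even using r_notin by (simp add: nf_def)
  qed
  then obtain k where k: "c - c' = 2 * k" by (rule evenE)
  have "nf (a - a') (b - b') (2 * k) \<otimes> nf a' b' c' = nf a b c"
    unfolding k[symmetric] nf_mult using \<open>even (c - c')\<close> by simp
  then have "nf (a - a') (b - b') (2 * k) = \<one>"
    unfolding eq using r_cancel_one' by (metis nf_closed)
  then obtain j where "b - b' + 2 ^ n * k = 2 ^ (n + 1) * j" "8 dvd a - a' + 2 * k - 4 * j"
    unfolding nf_even nf_eq_one by blast
  with k show thesis by (rule that)
qed

lemma nf_eqI:
  assumes "8 dvd a - a' - 4 * j" "b - b' = 2 ^ (n + 1) * j"
  shows "nf a b c = nf a' b' c"
proof -
  have "nf (a - a') (b - b') 0 = \<one>"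
    unfolding nf_eq_one using assms by auto
  moreover have "nf a b c = nf (a - a') (b - b') 0 \<otimes> nf a' b' c"
    by (simp add: nf_mult)
  ultimately show ?thesis by simp
qed

lemma carrier_nf: "x \<in> carrier G \<longleftrightarrow> (\<exists>a b c. x = nf a b c)"
proof -
  have "\<exists>a b c. x = nf a b c" if "x \<in> generate G {s, t, r}"
    using that
  proof (induction rule: generate.induct)
    case one
    then show ?case using nf_one by metis
  next
    case (incl h)
    then show ?case using nf_s nf_t nf_r by auto metis+
  next
    case (inv h)
    then show ?case
      using s_pow_nf[of "-1"] t_pow_nf[of "-1"] r_pow_nf[of "-1"] by (simp add: int_pow_neg) metis
  next
    case (eng h1 h2)
    then show ?case using nf_mult by metis
  qed
  with generated nf_closed show ?thesis by metis
qed


section \<open>Subgroups defined by parities of exponents\<close>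

text \<open>
  All arithmetic with the exponents \<open>2\<^sup>n\<close> and \<open>2\<^bsup>n+1\<^esup>\<close> is done in terms of \<open>m = 2\<^bsup>n-1\<^esup>\<close>. The case distinction
  between \<open>n = 1\<close> and \<open>n \<ge> 2\<close> in the theorem is the parity of \<open>m\<close>.
\<close>

lemma two_pow:
  obtains m :: int where "(2::int) ^ n = 2 * m" "(2::int) ^ (n + 1) = 4 * m" "m > 0"
    "n = 1 \<Longrightarrow> m = 1" "n \<noteq> 1 \<Longrightarrow> even m"
proof (rule that[of "2 ^ (n - 1)"])
  show "(2::int) ^ n = 2 * 2 ^ (n - 1)" using n by (cases n) auto
  show "(2::int) ^ (n + 1) = 4 * 2 ^ (n - 1)" using n by (cases n) auto
  show "n \<noteq> 1 \<Longrightarrow> even ((2::int) ^ (n - 1))" using n by simp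
qed simp_all

lemma inv_nf: "inv (nf a b 0) = nf (-a) (-b) 0"
  by (rule inv_equality) (simp_all add: nf_mult nf_one)

definition parity_kernel :: "int \<Rightarrow> int \<Rightarrow> int \<Rightarrow> 'a set" where
  "parity_kernel p q k = {nf a b c | a b c. even (p * a + q * b + k * c)}"

text \<open>
  The parities of the three exponents do not depend on the chosen normal form: by \<open>nf_eqD\<close>
  the ambiguities are multiples of \<open>(8, 0, 0)\<close>, \<open>(4, 2\<^bsup>n+1\<^esup>, 0)\<close> and \<open>(2, 2\<^sup>n, -2)\<close>, all of which are even because \<open>n \<ge> 1\<close>.
\<close>

lemma nf_in_parity_kernel: "nf a b c \<in> parity_kernel p q k \<longleftrightarrow> even (p * a + q * b + k * c)"
proof
  assume "nf a b c \<in> parity_kernel p q k"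
  then obtain a' b' c' where eq: "nf a b c = nf a' b' c'" and ev: "even (p * a' + q * b' + k * c')"
    unfolding parity_kernel_def by blast
  obtain m :: int where m: "(2::int) ^ n = 2 * m" "(2::int) ^ (n + 1) = 4 * m"
    using two_pow by metis
  from eq obtain i j where ij: "c - c' = 2 * i" "b - b' + 2 ^ n * i = 2 ^ (n + 1) * j"
    "8 dvd a - a' + 2 * i - 4 * j"
    by (rule nf_eqD)
  have "even (a - a')" using ij(3) by presburger
  moreover have "b - b' = 2 * (2 * (m * j) - m * i)"
    using ij(2) unfolding m by (simp add: algebra_simps)
  then have "even (b - b')" by simp
  moreover have "even (c - c')" using ij(1) by simp
  ultimately have "even a \<longleftrightarrow> even a'" "even b \<longleftrightarrow> even b'" "even c \<longleftrightarrow> even c'"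
    by presburger+
  with ev show "even (p * a + q * b + k * c)" by simp
qed (auto simp: parity_kernel_def)

lemma parity_set_parity_kernel: "parity_set (parity_kernel p q k)"
proof -
  have "x \<otimes> y \<in> parity_kernel p q k \<longleftrightarrow> (x \<in> parity_kernel p q k \<longleftrightarrow> y \<in> parity_kernel p q k)"
    if xy: "x \<in> carrier G" "y \<in> carrier G" for x y
  proof -
    obtain a b c a' b' c' where "x = nf a b c" "y = nf a' b' c'"
      using xy unfolding carrier_nf by blast
    then show ?thesis
      by (simp add: nf_mult nf_in_parity_kernel) blast
  qed
  moreover have "parity_kernel p q k \<subseteq> carrier G"
    unfolding parity_kernel_def by auto
  ultimately show ?thesis
    unfolding parity_set_def by blast
qed

lemma gen_in_parity_kernel:
  "s \<in> parity_kernel p q k \<longleftrightarrow> even p" "t \<in> parity_kernel p q k \<longleftrightarrow> even q" "r \<in> parity_kernel p q k \<longleftrightarrow> even k"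
  using nf_in_parity_kernel[of 1 0 0 p q k] nf_in_parity_kernel[of 0 1 0 p q k] nf_in_parity_kernel[of 0 0 1 p q k]
  by (simp_all add: nf_s nf_t nf_r)

lemma subgroup_parity_kernel: "subgroup (parity_kernel p q k) G"
  by (rule parity_set_subgroup[OF parity_set_parity_kernel])

lemma nf_pow_mem:
  assumes "subgroup S G" "nf a b 0 \<in> S"
  shows "nf (a * k) (b * k) 0 \<in> S"
  using subgroup_int_pow_closed[OF assms, of k] by (simp add: nf_pow mult.commute)

lemma nf_mult_mem:
  assumes "subgroup S G" "nf a b 0 \<in> S" "nf a' b' c \<in> S"
  shows "nf (a + a') (b + b') c \<in> S"
  using subgroup.m_closed[OF assms] by (simp add: nf_mult)

lemma r_pow_mem:
  assumes "subgroup S G" "r \<in> S"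
  shows "nf 0 0 c \<in> S"
  using subgroup_int_pow_closed[OF assms, of c] by (simp add: r_pow_nf)

lemma nat_pow_nf: "s [^] (k::nat) = nf (int k) 0 0" "t [^] (k::nat) = nf 0 (int k) 0"
  using s_pow_nf[of "int k"] t_pow_nf[of "int k"] by (simp_all add: int_pow_int)

lemma st_nf: "s \<otimes> t = nf 1 1 0"
  by (simp add: nf_def)

lemma generate_eq_parity_kernel:
  assumes "S \<subseteq> parity_kernel p q k" "parity_kernel p q k \<subseteq> generate G S"
  shows "generate G S = parity_kernel p q k"
  using generate_subgroup_incl[OF assms(1) subgroup_parity_kernel] assms(2) by (rule subset_antisym)

lemma subgroup_generate:
  assumes "S \<subseteq> parity_kernel p q k" shows "subgroup (generate G S) G"
  by (rule generate_is_subgroup[OF subset_trans[OF assms subgroup.subset[OF subgroup_parity_kernel]]])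

lemma generate_s_t: "generate G {s, t} = parity_kernel 0 0 1"
proof (rule generate_eq_parity_kernel)
  show X: "{s, t} \<subseteq> parity_kernel 0 0 1" by (simp add: gen_in_parity_kernel)
  note S = subgroup_generate[OF X]
  have st: "nf 1 0 0 \<in> generate G {s, t}" "nf 0 1 0 \<in> generate G {s, t}"
    by (auto simp: nf_s nf_t intro: generate.incl)
  show "parity_kernel 0 0 1 \<subseteq> generate G {s, t}"
  proof
    fix x assume "x \<in> parity_kernel 0 0 1"
    then obtain a b c where x: "x = nf a b c" and "even c" unfolding parity_kernel_def by auto
    then obtain k where "c = 2 * k" by blast
    then show "x \<in> generate G {s, t}"
      using nf_mult_mem[OF S nf_pow_mem[OF S st(1), of "a + 2 * k"] nf_pow_mem[OF S st(2), of "b + 2 ^ n * k"]]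
      by (simp add: x nf_even)
  qed
qed

lemma parity_kernel_010_subset:
  assumes S: "subgroup S G" and mem: "nf 1 0 0 \<in> S" "nf 0 2 0 \<in> S" "r \<in> S"
  shows "parity_kernel 0 1 0 \<subseteq> S"
proof
  fix x assume "x \<in> parity_kernel 0 1 0"
  then obtain a b c where x: "x = nf a b c" and "even b" unfolding parity_kernel_def by auto
  then obtain k where "b = 2 * k" by blast
  then show "x \<in> S"
    using nf_mult_mem[OF S nf_mult_mem[OF S nf_pow_mem[OF S mem(1), of a]
          nf_pow_mem[OF S mem(2), of k]] r_pow_mem[OF S mem(3), of c]]
    by (simp add: x)
qed

lemma parity_kernel_100_subset:
  assumes S: "subgroup S G" and mem: "nf 2 0 0 \<in> S" "nf 0 1 0 \<in> S" "r \<in> S"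
  shows "parity_kernel 1 0 0 \<subseteq> S"
proof
  fix x assume "x \<in> parity_kernel 1 0 0"
  then obtain a b c where x: "x = nf a b c" and "even a" unfolding parity_kernel_def by auto
  then obtain k where "a = 2 * k" by blast
  then show "x \<in> S"
    using nf_mult_mem[OF S nf_mult_mem[OF S nf_pow_mem[OF S mem(1), of k]
          nf_pow_mem[OF S mem(2), of b]] r_pow_mem[OF S mem(3), of c]]
    by (simp add: x)
qed

lemma parity_kernel_110_subset:
  assumes S: "subgroup S G" and mem: "nf 1 1 0 \<in> S" "nf 2 0 0 \<in> S" "r \<in> S"
  shows "parity_kernel 1 1 0 \<subseteq> S"
proof
  fix x assume "x \<in> parity_kernel 1 1 0"
  then obtain a b c where x: "x = nf a b c" and "even (a + b)" unfolding parity_kernel_def by auto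
  then have "even (a - b)" by simp
  then obtain k where "a - b = 2 * k" by blast
  then have "a = b + 2 * k" by simp
  then show "x \<in> S"
    using nf_mult_mem[OF S nf_mult_mem[OF S nf_pow_mem[OF S mem(1), of b]
          nf_pow_mem[OF S mem(2), of k]] r_pow_mem[OF S mem(3), of c]]
    by (simp add: x)
qed

lemma r_sq_mem:
  assumes "subgroup S G" "r \<in> S"
  shows "nf 2 (2 ^ n) 0 \<in> S"
  using r_pow_mem[OF assms, of 2] nf_even[of 0 0 1] by simp

lemma generate_s_t2_r: "generate G {s, t [^] (2::nat), r} = parity_kernel 0 1 0"
proof (rule generate_eq_parity_kernel)
  show X: "{s, t [^] (2::nat), r} \<subseteq> parity_kernel 0 1 0"
    by (simp add: gen_in_parity_kernel nat_pow_nf nf_in_parity_kernel)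
  show "parity_kernel 0 1 0 \<subseteq> generate G {s, t [^] (2::nat), r}"
    by (rule parity_kernel_010_subset[OF subgroup_generate[OF X]]) (auto simp: nat_pow_nf nf_s intro: generate.incl)
qed

text \<open>
  For \<open>n = 1\<close> the relation \<open>\<rho>\<^sup>2 = \<tau>\<^sup>2 \<sigma>\<^sup>2\<close> supplies the generator \<open>\<tau>\<^sup>2\<close>.
\<close>

lemma generate_s_r:
  assumes "n = 1"
  shows "generate G {s, r} = parity_kernel 0 1 0"
proof (rule generate_eq_parity_kernel)
  show X: "{s, r} \<subseteq> parity_kernel 0 1 0"
    by (simp add: gen_in_parity_kernel)
  note S = subgroup_generate[OF X]
  have sr: "nf 1 0 0 \<in> generate G {s, r}" "r \<in> generate G {s, r}"
    by (auto simp: nf_s intro: generate.incl)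
  have "nf 0 2 0 \<in> generate G {s, r}"
    using nf_mult_mem[OF S nf_pow_mem[OF S sr(1), of "-2"] r_sq_mem[OF S sr(2)]] assms
    by simp
  then show "parity_kernel 0 1 0 \<subseteq> generate G {s, r}"
    by (rule parity_kernel_010_subset[OF S sr(1) _ sr(2)])
qed

lemma generate_r_t: "generate G {r, t} = parity_kernel 1 0 0"
proof (rule generate_eq_parity_kernel)
  show X: "{r, t} \<subseteq> parity_kernel 1 0 0"
    by (simp add: gen_in_parity_kernel)
  note S = subgroup_generate[OF X]
  have rt: "r \<in> generate G {r, t}" "nf 0 1 0 \<in> generate G {r, t}"
    by (auto simp: nf_t intro: generate.incl)
  have "nf 2 0 0 \<in> generate G {r, t}"
    using nf_mult_mem[OF S nf_pow_mem[OF S rt(2), of "- (2 ^ n)"] r_sq_mem[OF S rt(1)]]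
    by simp
  then show "parity_kernel 1 0 0 \<subseteq> generate G {r, t}"
    by (rule parity_kernel_100_subset[OF S _ rt(2,1)])
qed

lemma generate_st_r_s2: "generate G {s \<otimes> t, r, s [^] (2::nat)} = parity_kernel 1 1 0"
proof (rule generate_eq_parity_kernel)
  show X: "{s \<otimes> t, r, s [^] (2::nat)} \<subseteq> parity_kernel 1 1 0"
    by (simp add: gen_in_parity_kernel nat_pow_nf nf_in_parity_kernel st_nf)
  show "parity_kernel 1 1 0 \<subseteq> generate G {s \<otimes> t, r, s [^] (2::nat)}"
    by (rule parity_kernel_110_subset[OF subgroup_generate[OF X]])
       (auto simp: nat_pow_nf st_nf intro: generate.incl)
qed

text \<open>
  For \<open>n \<ge> 2\<close> the exponent \<open>2\<^bsup>n+1\<^esup>\<close> is divisible by 8, so this power of \<open>\<sigma>\<tau>\<close> equals \<open>\<tau>\<^bsup>2^(n+1)\<^esup> = \<sigma>\<^sup>4\<close>. This is what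
  makes the additional generator \<open>\<sigma>\<^sup>2\<close> of the subgroup and \<open>\<sigma>\<^sup>4\<close> of its derived subgroup superfluous.
\<close>

lemma st_pow:
  assumes "n \<noteq> 1"
  shows "nf (2 ^ (n + 1)) (2 ^ (n + 1)) 0 = nf 4 0 0"
proof (rule nf_eqI[where j = 1])
  obtain m :: int where "(2::int) ^ (n + 1) = 4 * m" "even m"
    using two_pow assms by metis
  then show "8 dvd (2::int) ^ (n + 1) - 4 - 4 * 1"
    by presburger
qed simp

lemma generate_st_r:
  assumes "n \<noteq> 1"
  shows "generate G {s \<otimes> t, r} = parity_kernel 1 1 0"
proof (rule generate_eq_parity_kernel)
  show X: "{s \<otimes> t, r} \<subseteq> parity_kernel 1 1 0"
    by (simp add: gen_in_parity_kernel nf_in_parity_kernel st_nf)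
  note S = subgroup_generate[OF X]
  have st: "nf 1 1 0 \<in> generate G {s \<otimes> t, r}" and r': "r \<in> generate G {s \<otimes> t, r}"
    by (auto simp: st_nf intro: generate.incl)
  obtain m :: int where m: "(2::int) ^ n = 2 * m" "even m"
    using two_pow assms by metis
  then obtain l where l: "m = 2 * l" by blast
  have 4: "nf 4 0 0 \<in> generate G {s \<otimes> t, r}"
    using nf_pow_mem[OF S st, of "2 ^ (n + 1)"] st_pow[OF assms] by simp
  \<comment> \<open>The element \<open>\<sigma>\<^bsup>4l\<^esup> (\<sigma>\<tau>)\<^bsup>-4l\<^esup> \<rho>\<^sup>2\<close>, which is \<open>\<sigma>\<^sup>2\<close> because \<open>4l = 2\<^sup>n\<close>.\<close>
  have "nf (2 - 4 * l + 4 * l) (2 ^ n - 4 * l) 0 \<in> generate G {s \<otimes> t, r}"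
    using nf_mult_mem[OF S nf_pow_mem[OF S 4, of l]
      nf_mult_mem[OF S nf_pow_mem[OF S st, of "- (4 * l)"] r_sq_mem[OF S r']]]
    by (simp add: algebra_simps)
  then have "nf 2 0 0 \<in> generate G {s \<otimes> t, r}"
    by (simp add: m l)
  then show "parity_kernel 1 1 0 \<subseteq> generate G {s \<otimes> t, r}"
    by (rule parity_kernel_110_subset[OF S st _ r'])
qed


section \<open>Derived subgroups and lattices of exponents\<close>

text \<open>
  A subgroup of \<open>\<int>\<^sup>2\<close>, given by its membership predicate, that contains the exponents \<open>(8, 0)\<close> and
  \<open>(4, 2\<^bsup>n+1\<^esup>)\<close> of the relations of \<open>\<langle>\<sigma>, \<tau>\<rangle>\<close>. Subgroups of \<open>\<langle>\<sigma>, \<tau>\<rangle>\<close> correspond to such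
  lattices.
\<close>

definition lattice_pred :: "(int \<Rightarrow> int \<Rightarrow> bool) \<Rightarrow> bool" where
  "lattice_pred P \<longleftrightarrow> P 0 0 \<and> (\<forall>a b a' b'. P a b \<longrightarrow> P a' b' \<longrightarrow> P (a - a') (b - b')) \<and>
     P 8 0 \<and> P 4 (2 ^ (n + 1))"

definition lattice_subgroup :: "(int \<Rightarrow> int \<Rightarrow> bool) \<Rightarrow> 'a set" where
  "lattice_subgroup P = {nf a b 0 | a b. P a b}"

lemma nf_in_lattice_subgroupI: "P a b \<Longrightarrow> nf a b 0 \<in> lattice_subgroup P"
  unfolding lattice_subgroup_def by blast

lemma lattice_pred_diff: "lattice_pred P \<Longrightarrow> P a b \<Longrightarrow> P a' b' \<Longrightarrow> P (a - a') (b - b')"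
  and lattice_pred_zero: "lattice_pred P \<Longrightarrow> P 0 0"
  unfolding lattice_pred_def by blast+

lemma lattice_pred_neg: "lattice_pred P \<Longrightarrow> P a b \<Longrightarrow> P (- a) (- b)"
  using lattice_pred_diff[of P 0 0 a b] lattice_pred_zero[of P] by simp

lemma lattice_pred_add: "lattice_pred P \<Longrightarrow> P a b \<Longrightarrow> P a' b' \<Longrightarrow> P (a + a') (b + b')"
  using lattice_pred_diff[of P a b "- a'" "- b'"] lattice_pred_neg[of P a' b'] by simp

lemma lattice_pred_mult:
  assumes P: "lattice_pred P" "P a b"
  shows "P (k * a) (k * b)"
proof (induction k rule: int_induct[where k = 0])
  case base
  then show ?case using lattice_pred_zero P by simp
next
  case (step1 i)
  from lattice_pred_add[OF P(1) this(2) P(2)] show ?case by (simp add: algebra_simps)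
next
  case (step2 i)
  from lattice_pred_diff[OF P(1) this(2) P(2)] show ?case by (simp add: algebra_simps)
qed

text \<open>
  Membership in a subgroup of \<open>\<langle>\<sigma>, \<tau>\<rangle>\<close> is decided on exponents, since its lattice absorbs the ambiguity
  of the normal form.
\<close>

lemma nf_in_lattice_subgroup:
  assumes P: "lattice_pred P"
  shows "nf a b c \<in> lattice_subgroup P \<longleftrightarrow> (\<exists>k. c = 2 * k \<and> P (a + 2 * k) (b + 2 ^ n * k))"
proof
  assume "nf a b c \<in> lattice_subgroup P"
  then obtain a' b' where eq: "nf a b c = nf a' b' 0" and P': "P a' b'"
    unfolding lattice_subgroup_def by blast
  from eq obtain j k where jk: "c - 0 = 2 * k" "b - b' + 2 ^ n * k = 2 ^ (n + 1) * j"
    "8 dvd a - a' + 2 * k - 4 * j"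
    by (rule nf_eqD)
  from jk(3) obtain i where i: "a - a' + 2 * k - 4 * j = 8 * i" ..
  have P84: "P 8 0" "P 4 (2 ^ (n + 1))" using P unfolding lattice_pred_def by blast+
  have "P (a' + (j * 4 + i * 8)) (b' + (j * 2 ^ (n + 1) + i * 0))"
    by (rule lattice_pred_add[OF P P' lattice_pred_add[OF P
          lattice_pred_mult[OF P P84(2)] lattice_pred_mult[OF P P84(1)]]])
  moreover have "a' + (j * 4 + i * 8) = a + 2 * k" using i by simp
  moreover have "b' + (j * 2 ^ (n + 1) + i * 0) = b + 2 ^ n * k" using jk(2) by (simp add: algebra_simps)
  ultimately show "\<exists>k. c = 2 * k \<and> P (a + 2 * k) (b + 2 ^ n * k)"
    using jk(1) by auto
next
  assume "\<exists>k. c = 2 * k \<and> P (a + 2 * k) (b + 2 ^ n * k)"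
  then show "nf a b c \<in> lattice_subgroup P"
    unfolding lattice_subgroup_def using nf_even by blast
qed

lemma subgroup_of_lattice:
  assumes P: "lattice_pred P" shows "subgroup (lattice_subgroup P) G"
proof (rule subgroupI)
  show "lattice_subgroup P \<subseteq> carrier G" "lattice_subgroup P \<noteq> {}"
    unfolding lattice_subgroup_def using lattice_pred_zero[OF P] by auto
  show "inv x \<in> lattice_subgroup P" if "x \<in> lattice_subgroup P" for x
  proof -
    from that obtain a b where "x = nf a b 0" "P a b" unfolding lattice_subgroup_def by blast
    then show ?thesis unfolding lattice_subgroup_def inv_nf using lattice_pred_neg[OF P] inv_nf by blast
  qed
  show "x \<otimes> y \<in> lattice_subgroup P" if "x \<in> lattice_subgroup P" "y \<in> lattice_subgroup P" for x y
  proof -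
    from that obtain a b a' b' where "x = nf a b 0" "P a b" "y = nf a' b' 0" "P a' b'"
      unfolding lattice_subgroup_def by blast
    moreover from this have "x \<otimes> y = nf (a + a') (b + b') 0" by (simp add: nf_mult)
    ultimately show ?thesis unfolding lattice_subgroup_def using lattice_pred_add[OF P] by blast
  qed
qed

text \<open>
  The commutator is bilinear in the parities of the \<open>\<rho>\<close>-exponents and the remaining exponents:
  \<open>\<rho>\<close> acts on \<open>\<sigma>\<^sup>a \<tau>\<^sup>b\<close> by \<open>(a, b) \<mapsto> (a + 2a, b - 2b)\<close>, and \<open>c mod 2\<close> tells whether it acts.
\<close>

lemma nf_commute:
  "nf a b c \<otimes> nf a' b' c' =
    nf (2 * ((c mod 2) * a' - (c' mod 2) * a)) (- 2 * ((c mod 2) * b' - (c' mod 2) * b)) 0 \<otimes>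
    (nf a' b' c' \<otimes> nf a b c)"
proof -
  have "d mod 2 = (if even d then 0 else 1)" for d :: int
    by presburger
  then show ?thesis
    by (cases "even c"; cases "even c'") (simp_all add: nf_mult algebra_simps)
qed

lemma commutator_in_derived:
  assumes "nf a b c \<in> H" "nf a' b' c' \<in> H"
  shows "nf (2 * ((c mod 2) * a' - (c' mod 2) * a)) (- 2 * ((c mod 2) * b' - (c' mod 2) * b)) 0 \<in> derived G H"
proof -
  let ?x = "nf a b c" and ?y = "nf a' b' c'"
  let ?d = "nf (2 * ((c mod 2) * a' - (c' mod 2) * a)) (- 2 * ((c mod 2) * b' - (c' mod 2) * b)) 0"
  have "?x \<otimes> ?y \<otimes> inv ?x \<otimes> inv ?y = ?d \<otimes> (?y \<otimes> (?x \<otimes> inv ?x)) \<otimes> inv ?y"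
    unfolding nf_commute[of a b c] by (simp only: m_assoc m_closed inv_closed nf_closed)
  also have "\<dots> = ?d"
    by (simp add: m_assoc)
  finally have "?x \<otimes> ?y \<otimes> inv ?x \<otimes> inv ?y = ?d" .
  moreover have "?x \<otimes> ?y \<otimes> inv ?x \<otimes> inv ?y \<in> derived G H"
    unfolding derived_def using assms by (intro generate.incl) blast
  ultimately show ?thesis
    by simp
qed

text \<open>
  A circle of inclusions: the derived subgroup lies in the lattice subgroup by the commutator formula,
  the latter is generated by \<open>S\<close>, and \<open>S\<close> consists of elements of the derived subgroup.
\<close>

lemma derived_eq_lattice_subgroup:
  assumes P: "lattice_pred P" and H: "H = parity_kernel p q k"
    and comm: "\<And>a b c a' b' c'. even (p * a + q * b + k * c) \<Longrightarrow> even (p * a' + q * b' + k * c') \<Longrightarrow>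
      P (2 * ((c mod 2) * a' - (c' mod 2) * a)) (- 2 * ((c mod 2) * b' - (c' mod 2) * b))"
    and gen: "lattice_subgroup P \<subseteq> generate G S" and S: "S \<subseteq> derived G H"
  shows "derived G H = lattice_subgroup P" "derived G H = generate G S"
proof -
  have Hc: "H \<subseteq> carrier G" unfolding H by (rule subgroup.subset[OF subgroup_parity_kernel])
  have "derived G H \<subseteq> lattice_subgroup P"
  proof (rule derived_subsetI[OF Hc subgroup_of_lattice[OF P]])
    fix x y assume "x \<in> H" "y \<in> H"
    then obtain a b c a' b' c' where x: "x = nf a b c" "even (p * a + q * b + k * c)"
      and y: "y = nf a' b' c'" "even (p * a' + q * b' + k * c')"
      unfolding H parity_kernel_def by blast
    show "\<exists>d\<in>lattice_subgroup P. x \<otimes> y = d \<otimes> (y \<otimes> x)"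
      unfolding x(1) y(1) lattice_subgroup_def using nf_commute comm[OF x(2) y(2)] by blast
  qed
  moreover have "generate G S \<subseteq> derived G H"
    by (rule generate_subgroup_incl[OF S derived_is_subgroup[OF Hc]])
  ultimately show "derived G H = lattice_subgroup P" "derived G H = generate G S"
    using gen by blast+
qed

lemma derived_parity_kernel_001:
  "derived G (parity_kernel 0 0 1) = {\<one>}"
proof -
  have "derived G (parity_kernel 0 0 1) \<subseteq> {\<one>}"
  proof (rule derived_subsetI[OF subgroup.subset[OF subgroup_parity_kernel] triv_subgroup])
    fix x y assume "x \<in> parity_kernel 0 0 1" "y \<in> parity_kernel 0 0 1"
    then obtain a b c a' b' c' where "x = nf a b c" "even c" "y = nf a' b' c'" "even c'"
      unfolding parity_kernel_def by auto
    then show "\<exists>d\<in>{\<one>}. x \<otimes> y = d \<otimes> (y \<otimes> x)"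
      by (simp add: nf_mult add.commute)
  qed
  then show ?thesis
    using subgroup.one_closed[OF derived_is_subgroup[OF subgroup.subset[OF subgroup_parity_kernel]]] by blast
qed

lemma dvd_two_pow: "4 dvd (2::int) ^ (n + 1)" "even ((2::int) ^ n)"
  using two_pow by (metis dvd_triv_left)+

text \<open>
  The lattices of the subgroups generated by \<open>\<sigma>\<^sup>2, \<tau>\<^sup>4\<close>, by \<open>\<tau>\<^sup>2\<close> (and \<open>\<sigma>\<^sup>4\<close>, which is a power of \<open>\<tau>\<^sup>2\<close>), and by
  \<open>(\<sigma>\<tau>)\<^sup>2, \<sigma>\<^sup>4\<close>. They are the three
  sublattices of index two in \<open>2\<int> \<times> 2\<int>\<close> that contain \<open>4\<int> \<times> 4\<int>\<close>.
\<close>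

abbreviation s2_t4_lattice :: "int \<Rightarrow> int \<Rightarrow> bool" where "s2_t4_lattice a b \<equiv> even a \<and> 4 dvd b"
abbreviation t2_lattice :: "int \<Rightarrow> int \<Rightarrow> bool" where "t2_lattice a b \<equiv> 4 dvd a \<and> even b"
abbreviation st2_s4_lattice :: "int \<Rightarrow> int \<Rightarrow> bool" where "st2_s4_lattice a b \<equiv> even b \<and> 4 dvd a - b"

lemma lattice_pred_s2_t4: "lattice_pred s2_t4_lattice"
  unfolding lattice_pred_def using dvd_two_pow(1) by (auto simp: dvd_diff)
lemma lattice_pred_t2: "lattice_pred t2_lattice"
  unfolding lattice_pred_def using dvd_two_pow(1) by (auto simp: dvd_diff)
lemma lattice_pred_st2_s4: "lattice_pred st2_s4_lattice"
proof -
  have "4 dvd 4 - (2::int) ^ (n + 1)" using dvd_two_pow(1) by presburger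
  moreover have "4 dvd (a - a') - (b - b')" if "4 dvd a - b" "4 dvd a' - b'" for a a' b b' :: int
    using that by presburger
  ultimately show ?thesis
    unfolding lattice_pred_def by auto
qed

text \<open>
  The generating set is left open because one of the two elements is redundant for some \<open>n\<close>: here
  \<open>\<tau>\<^sup>4 = \<sigma>\<^sup>4\<close> is a power of \<open>\<sigma>\<^sup>2\<close> when \<open>n = 1\<close>, and in \<open>derived_parity_kernel_110_generate\<close> the element \<open>\<sigma>\<^sup>4\<close> is a power of \<open>(\<sigma>\<tau>)\<^sup>2\<close> when
  \<open>n \<ge> 2\<close>.
\<close>

lemma derived_parity_kernel_010_generate:
  assumes S: "nf 2 0 0 \<in> generate G S" "nf 0 4 0 \<in> generate G S" "S \<subseteq> {nf 2 0 0, nf 0 4 0}"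
  shows "derived G (parity_kernel 0 1 0) = lattice_subgroup s2_t4_lattice" "derived G (parity_kernel 0 1 0) = generate G S"
proof -
  have sub: "subgroup (generate G S) G"
    by (rule generate_is_subgroup) (use S(3) in auto)
  have Hsub: "subgroup (derived G (parity_kernel 0 1 0)) G"
    by (rule derived_is_subgroup[OF subgroup.subset[OF subgroup_parity_kernel]])
  have "s2_t4_lattice (2 * ((c mod 2) * a' - (c' mod 2) * a)) (- 2 * ((c mod 2) * b' - (c' mod 2) * b))"
    if "even (0 * a + 1 * b + 0 * c)" "even (0 * a' + 1 * b' + 0 * c')" for a b c a' b' c' :: int
    using that by (auto elim!: evenE)
  moreover have "lattice_subgroup s2_t4_lattice \<subseteq> generate G S"
  proof
    fix x assume "x \<in> lattice_subgroup s2_t4_lattice"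
    then obtain a b where x: "x = nf a b 0" "even a" "4 dvd b" unfolding lattice_subgroup_def by blast
    from x(2) obtain i where i: "a = 2 * i" ..
    from x(3) obtain j where j: "b = 4 * j" ..
    show "x \<in> generate G S"
      using nf_mult_mem[OF sub nf_pow_mem[OF sub S(1), of i] nf_pow_mem[OF sub S(2), of j]]
      by (simp add: x i j)
  qed
  moreover have "S \<subseteq> derived G (parity_kernel 0 1 0)"
  proof -
    have "nf 2 0 0 \<in> derived G (parity_kernel 0 1 0)"
      using commutator_in_derived[of 0 0 1 "parity_kernel 0 1 0" 1 0 0] by (simp add: nf_in_parity_kernel)
    moreover have "nf 0 (-4) 0 \<in> derived G (parity_kernel 0 1 0)"
      using commutator_in_derived[of 0 0 1 "parity_kernel 0 1 0" 0 2 0] by (simp add: nf_in_parity_kernel)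
    from nf_pow_mem[OF Hsub this, of "-1"] have "nf 0 4 0 \<in> derived G (parity_kernel 0 1 0)" by simp
    ultimately show ?thesis using S(3) by blast
  qed
  ultimately show "derived G (parity_kernel 0 1 0) = lattice_subgroup s2_t4_lattice" "derived G (parity_kernel 0 1 0) = generate G S"
    using derived_eq_lattice_subgroup[OF lattice_pred_s2_t4 refl, of 0 1 0 S] by blast+
qed

lemma derived_parity_kernel_100_generate:
  assumes S: "nf 0 2 0 \<in> generate G S" "S \<subseteq> {nf 0 2 0}"
  shows "derived G (parity_kernel 1 0 0) = lattice_subgroup t2_lattice" "derived G (parity_kernel 1 0 0) = generate G S"
proof -
  have sub: "subgroup (generate G S) G"
    by (rule generate_is_subgroup) (use S(2) in auto)
  have Hsub: "subgroup (derived G (parity_kernel 1 0 0)) G"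
    by (rule derived_is_subgroup[OF subgroup.subset[OF subgroup_parity_kernel]])
  have "t2_lattice (2 * ((c mod 2) * a' - (c' mod 2) * a)) (- 2 * ((c mod 2) * b' - (c' mod 2) * b))"
    if "even (1 * a + 0 * b + 0 * c)" "even (1 * a' + 0 * b' + 0 * c')" for a b c a' b' c' :: int
    using that by (auto elim!: evenE)
  moreover have "lattice_subgroup t2_lattice \<subseteq> generate G S"
  proof
    fix x assume "x \<in> lattice_subgroup t2_lattice"
    then obtain a b where x: "x = nf a b 0" "4 dvd a" "even b" unfolding lattice_subgroup_def by blast
    from x(2) obtain i where i: "a = 4 * i" ..
    from x(3) obtain j where j: "b = 2 * j" ..
    have "nf a b 0 = nf 0 (b - 2 ^ (n + 1) * i) 0"
    proof (rule nf_eqI[where j = i])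
    qed (simp_all add: i)
    moreover have "b - 2 ^ (n + 1) * i = 2 * (j - 2 ^ n * i)"
      by (simp add: j algebra_simps)
    ultimately have "x = nf (0 * (j - 2 ^ n * i)) (2 * (j - 2 ^ n * i)) 0"
      unfolding x(1) by (simp only: mult_zero_left)
    then show "x \<in> generate G S"
      using nf_pow_mem[OF sub S(1), of "j - 2 ^ n * i"] by (simp only:)
  qed
  moreover have "S \<subseteq> derived G (parity_kernel 1 0 0)"
  proof -
    have "nf 0 (-2) 0 \<in> derived G (parity_kernel 1 0 0)"
      using commutator_in_derived[of 0 0 1 "parity_kernel 1 0 0" 0 1 0] by (simp add: nf_in_parity_kernel)
    from nf_pow_mem[OF Hsub this, of "-1"] have "nf 0 2 0 \<in> derived G (parity_kernel 1 0 0)" by simp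
    then show ?thesis using S(2) by blast
  qed
  ultimately show "derived G (parity_kernel 1 0 0) = lattice_subgroup t2_lattice" "derived G (parity_kernel 1 0 0) = generate G S"
    using derived_eq_lattice_subgroup[OF lattice_pred_t2 refl, of 1 0 0 S] by blast+
qed

lemma derived_parity_kernel_110_generate:
  assumes S: "nf 2 2 0 \<in> generate G S" "nf 4 0 0 \<in> generate G S" "S \<subseteq> {nf 2 2 0, nf 4 0 0}"
  shows "derived G (parity_kernel 1 1 0) = lattice_subgroup st2_s4_lattice" "derived G (parity_kernel 1 1 0) = generate G S"
proof -
  have sub: "subgroup (generate G S) G"
    by (rule generate_is_subgroup) (use S(3) in auto)
  have Hsub: "subgroup (derived G (parity_kernel 1 1 0)) G"
    by (rule derived_is_subgroup[OF subgroup.subset[OF subgroup_parity_kernel]])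
  have "st2_s4_lattice (2 * ((c mod 2) * a' - (c' mod 2) * a)) (- 2 * ((c mod 2) * b' - (c' mod 2) * b))"
    if "even (1 * a + 1 * b + 0 * c)" "even (1 * a' + 1 * b' + 0 * c')" for a b c a' b' c' :: int
  proof -
    from that have "even (a + b)" "even (a' + b')" by simp_all
    then obtain u v where "a + b = 2 * u" "a' + b' = 2 * v" by (metis evenE)
    have "2 * ((c mod 2) * a' - (c' mod 2) * a) - (- 2 * ((c mod 2) * b' - (c' mod 2) * b))
      = 2 * ((c mod 2) * (a' + b') - (c' mod 2) * (a + b))"
      by (simp add: algebra_simps)
    also have "\<dots> = 4 * ((c mod 2) * v - (c' mod 2) * u)"
      unfolding \<open>a + b = 2 * u\<close> \<open>a' + b' = 2 * v\<close> by (simp add: algebra_simps)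
    finally show ?thesis by (metis dvd_mult2 dvd_triv_left even_minus mult_minus_left)
  qed
  moreover have "lattice_subgroup st2_s4_lattice \<subseteq> generate G S"
  proof
    fix x assume "x \<in> lattice_subgroup st2_s4_lattice"
    then obtain a b where x: "x = nf a b 0" "even b" "4 dvd a - b" unfolding lattice_subgroup_def by blast
    from x(3) obtain i where i: "a - b = 4 * i" ..
    from x(2) obtain j where j: "b = 2 * j" ..
    have a: "a = 2 * j + 4 * i" using i j by simp
    show "x \<in> generate G S"
      using nf_mult_mem[OF sub nf_pow_mem[OF sub S(1), of j] nf_pow_mem[OF sub S(2), of i]]
      by (simp add: x a j)
  qed
  moreover have "S \<subseteq> derived G (parity_kernel 1 1 0)"
  proof -
    have 4: "nf 4 0 0 \<in> derived G (parity_kernel 1 1 0)"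
      using commutator_in_derived[of 0 0 1 "parity_kernel 1 1 0" 2 0 0] by (simp add: nf_in_parity_kernel)
    have "nf 2 (-2) 0 \<in> derived G (parity_kernel 1 1 0)"
      using commutator_in_derived[of 0 0 1 "parity_kernel 1 1 0" 1 1 0] by (simp add: nf_in_parity_kernel)
    from nf_mult_mem[OF Hsub nf_pow_mem[OF Hsub this, of "-1"] 4]
    have "nf 2 2 0 \<in> derived G (parity_kernel 1 1 0)" by simp
    then show ?thesis using S(3) 4 by blast
  qed
  ultimately show "derived G (parity_kernel 1 1 0) = lattice_subgroup st2_s4_lattice" "derived G (parity_kernel 1 1 0) = generate G S"
    using derived_eq_lattice_subgroup[OF lattice_pred_st2_s4 refl, of 1 1 0 S] by blast+
qed


section \<open>Abelianizations\<close>

lemma nf_add_even: "nf a b (c + 2 * k) = nf (a + 2 * k) (b + 2 ^ n * k) c"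
proof -
  have "nf a b (2 * k) \<otimes> nf 0 0 c = nf a b (2 * k + c)" by (simp add: nf_mult)
  then show ?thesis by (simp add: nf_even nf_mult add.commute)
qed

lemma s_r_nf: "s [^] (i::int) \<otimes> r [^] (j::int) = nf i 0 j" and t_r_nf: "t [^] (i::int) \<otimes> r [^] (j::int) = nf 0 i j"
  by (simp_all add: nf_def)

lemma derived_parity_kernel_010: "derived G (parity_kernel 0 1 0) = lattice_subgroup s2_t4_lattice"
  by (rule derived_parity_kernel_010_generate(1)[of "{nf 2 0 0, nf 0 4 0}"]) (auto intro: generate.incl)

lemma derived_parity_kernel_100: "derived G (parity_kernel 1 0 0) = lattice_subgroup t2_lattice"
  by (rule derived_parity_kernel_100_generate(1)[of "{nf 0 2 0}"]) (auto intro: generate.incl)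

lemma derived_parity_kernel_110: "derived G (parity_kernel 1 1 0) = lattice_subgroup st2_s4_lattice"
  by (rule derived_parity_kernel_110_generate(1)[of "{nf 2 2 0, nf 4 0 0}"]) (auto intro: generate.incl)

text \<open>
  The subgroup is \<open>\<langle>\<sigma>, \<tau>\<rangle>\<close> itself. Its element \<open>\<sigma> \<tau>\<^bsup>-m\<^esup>\<close> with \<open>m = 2\<^bsup>n-1\<^esup>\<close> has order 4 because
  \<open>\<sigma>\<^sup>4 = \<tau>\<^bsup>4m\<^esup>\<close>, and together with \<open>\<tau>\<close> it gives a direct decomposition.
\<close>

lemma of_type_parity_kernel_001: "of_type (abelianization G (parity_kernel 0 0 1)) [2 ^ 2, 2 ^ (n + 2)]"
proof -
  obtain m :: int where m: "(2::int) ^ (n + 1) = 4 * m" "m > 0"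
    using two_pow by metis
  have m2: "(2::int) ^ (n + 2) = 8 * m" using m(1) by simp
  have xy: "nf 1 (- m) 0 [^] i \<otimes> t [^] j = nf i (j - i * m) 0" for i j :: int
    unfolding nf_pow t_pow_nf by (simp add: nf_mult)
  show ?thesis
  proof (rule of_type_pairI[OF subgroup_parity_kernel, of "nf 1 (- m) 0" _ _ _ t])
    fix h assume "h \<in> parity_kernel 0 0 1"
    then obtain a b c where h: "h = nf a b c" and "even c" unfolding parity_kernel_def by auto
    then obtain k where k: "c = 2 * k" by blast
    have "h = \<one> \<otimes> (nf 1 (- m) 0 [^] (a + 2 * k) \<otimes> t [^] (b + 2 ^ n * k + (a + 2 * k) * m))"
      unfolding xy h k nf_even by simp
    then show "\<exists>(i::int) (j::int). \<exists>d\<in>derived G (parity_kernel 0 0 1). h = d \<otimes> (nf 1 (- m) 0 [^] i \<otimes> t [^] j)"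
      unfolding derived_parity_kernel_001 by blast
  next
    fix i j :: int
    have "(\<exists>k. j - i * m = 4 * m * k \<and> 8 dvd i - 4 * k) \<longleftrightarrow> 4 dvd i \<and> 8 * m dvd j"
    proof
      assume "\<exists>k. j - i * m = 4 * m * k \<and> 8 dvd i - 4 * k"
      then obtain k where k: "j - i * m = 4 * m * k" "8 dvd i - 4 * k" by blast
      from k(2) obtain l where "i - 4 * k = 8 * l" ..
      note kl = k(1) this
      then have i: "i = 4 * k + 8 * l" by simp
      then have "j = 8 * m * (k + l)" using kl(1) by (simp add: algebra_simps)
      then show "4 dvd i \<and> 8 * m dvd j" unfolding i by simp
    next
      assume "4 dvd i \<and> 8 * m dvd j"
      then obtain k l where kl: "i = 4 * k" "j = 8 * m * l" by (auto elim!: dvdE)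
      show "\<exists>k. j - i * m = 4 * m * k \<and> 8 dvd i - 4 * k"
        by (rule exI[of _ "2 * l - k"]) (simp add: kl algebra_simps flip: right_diff_distrib)
    qed
    then show "(nf 1 (- m) 0 [^] i \<otimes> t [^] j \<in> derived G (parity_kernel 0 0 1)) =
        (int (2 ^ 2) dvd i \<and> int (2 ^ (n + 2)) dvd j)"
      unfolding derived_parity_kernel_001 xy using nf_eq_one[of i "j - i * m"] m m2 by simp
  qed (simp_all add: nf_in_parity_kernel gen_in_parity_kernel)
qed

text \<open>
  For \<open>n = 1\<close> the square of \<open>\<rho>\<close> is \<open>\<tau>\<^sup>2\<close> modulo \<open>\<sigma>\<^sup>2\<close>, which is not in the derived subgroup; so \<open>\<rho>\<close> has order 4 there and
  replaces \<open>\<tau>\<^sup>2\<close> as a generator. For \<open>n \<ge> 2\<close> the square of \<open>\<rho>\<close> is trivial, which is the reason for the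
  different type.
\<close>

lemma of_type_parity_kernel_010_n1:
  assumes "n = 1"
  shows "of_type (abelianization G (parity_kernel 0 1 0)) [2, 4]"
proof (rule of_type_pairI[OF subgroup_parity_kernel, of s _ _ _ r], unfold s_r_nf derived_parity_kernel_010)
  fix h assume "h \<in> parity_kernel 0 1 0"
  then obtain a b c where h: "h = nf a b c" and "even b" unfolding parity_kernel_def by auto
  then obtain k where k: "b = 2 * k" by blast
  have "h = nf (- 2 * k) 0 0 \<otimes> nf a 0 (c + 2 * k)"
    unfolding nf_add_even using assms by (simp add: h k nf_mult)
  moreover have "nf (- 2 * k) 0 0 \<in> lattice_subgroup s2_t4_lattice"
    by (rule nf_in_lattice_subgroupI) simp
  ultimately show "\<exists>i j. \<exists>d\<in>lattice_subgroup s2_t4_lattice. h = d \<otimes> nf i 0 j"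
    by blast
next
  fix i j :: int
  show "(nf i 0 j \<in> lattice_subgroup s2_t4_lattice) = (int 2 dvd i \<and> int 4 dvd j)"
    unfolding nf_in_lattice_subgroup[OF lattice_pred_s2_t4] using assms by (auto elim!: evenE)
qed (simp_all add: gen_in_parity_kernel)

lemma of_type_parity_kernel_010:
  assumes "n \<noteq> 1"
  shows "of_type (abelianization G (parity_kernel 0 1 0)) [2, 2, 2]"
proof -
  have prod: "s [^] (i::int) \<otimes> (nf 0 2 0 [^] (j::int) \<otimes> r [^] (k::int)) = nf i (2 * j) k" for i j k
    unfolding nf_pow by (simp add: s_pow_nf r_pow_nf nf_mult mult.commute)
  show ?thesis
  proof (rule of_type_tripleI[OF subgroup_parity_kernel, of s _ _ _ "nf 0 2 0" r], unfold prod derived_parity_kernel_010)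
    fix h assume "h \<in> parity_kernel 0 1 0"
    then obtain a b c where h: "h = nf a b c" and "even b" unfolding parity_kernel_def by auto
    then obtain k where k: "b = 2 * k" by blast
    have "h = nf 0 0 0 \<otimes> nf a (2 * k) c"
      by (simp add: h k nf_mult)
    moreover have "nf 0 0 0 \<in> lattice_subgroup s2_t4_lattice"
      by (rule nf_in_lattice_subgroupI) simp
    ultimately show "\<exists>i j k. \<exists>d\<in>lattice_subgroup s2_t4_lattice. h = d \<otimes> nf i (2 * j) k"
      by blast
  next
    fix i j k :: int
    obtain m :: int where m: "(2::int) ^ n = 2 * m" "even m"
      using two_pow assms by metis
    then obtain l where l: "m = 2 * l" by blast
    have "4 dvd 2 * j + 2 ^ n * x \<longleftrightarrow> even j" for x
    proof -
      have "2 * j + 2 ^ n * x = 2 * j + 4 * (l * x)" by (simp add: m l)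
      then show ?thesis by presburger
    qed
    then show "(nf i (2 * j) k \<in> lattice_subgroup s2_t4_lattice) = (int 2 dvd i \<and> int 2 dvd j \<and> int 2 dvd k)"
      unfolding nf_in_lattice_subgroup[OF lattice_pred_s2_t4] by (auto elim!: evenE)
  qed (simp_all add: gen_in_parity_kernel nf_in_parity_kernel)
qed

lemma of_type_parity_kernel_100: "of_type (abelianization G (parity_kernel 1 0 0)) [2, 4]"
proof (rule of_type_pairI[OF subgroup_parity_kernel, of t _ _ _ r], unfold t_r_nf derived_parity_kernel_100)
  fix h assume "h \<in> parity_kernel 1 0 0"
  then obtain a b c where h: "h = nf a b c" and "even a" unfolding parity_kernel_def by auto
  then obtain k where k: "a = 2 * k" by blast
  have "h = nf 0 (- (2 ^ n) * k) 0 \<otimes> nf 0 b (c + 2 * k)"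
    unfolding nf_add_even by (simp add: h k nf_mult)
  moreover have "nf 0 (- (2 ^ n) * k) 0 \<in> lattice_subgroup t2_lattice"
    using dvd_two_pow(2) by (intro nf_in_lattice_subgroupI) simp
  ultimately show "\<exists>i j. \<exists>d\<in>lattice_subgroup t2_lattice. h = d \<otimes> nf 0 i j"
    by blast
next
  fix i j :: int
  show "(nf 0 i j \<in> lattice_subgroup t2_lattice) = (int 2 dvd i \<and> int 4 dvd j)"
    unfolding nf_in_lattice_subgroup[OF lattice_pred_t2] using dvd_two_pow(2) by (auto elim!: dvdE)
qed (simp_all add: gen_in_parity_kernel)

text \<open>
  Here \<open>\<rho>\<^sup>2\<close> is \<open>(\<sigma>\<tau>)\<^sup>2\<close> for \<open>n = 1\<close>, hence trivial in the quotient, whereas for \<open>n \<ge> 2\<close> it is \<open>\<sigma>\<^sup>2\<close> modulo the derived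
  subgroup, which is not trivial, and \<open>\<rho>\<close> has order 4.
\<close>

lemma of_type_parity_kernel_110_n1:
  assumes "n = 1"
  shows "of_type (abelianization G (parity_kernel 1 1 0)) [2, 2, 2]"
proof -
  have prod: "nf 1 1 0 [^] (i::int) \<otimes> (nf 2 0 0 [^] (j::int) \<otimes> r [^] (k::int)) = nf (i + 2 * j) i k" for i j k
    unfolding nf_pow by (simp add: r_pow_nf nf_mult mult.commute)
  show ?thesis
  proof (rule of_type_tripleI[OF subgroup_parity_kernel, of "nf 1 1 0" _ _ _ "nf 2 0 0" r], unfold prod derived_parity_kernel_110)
    fix h assume "h \<in> parity_kernel 1 1 0"
    then obtain a b c where h: "h = nf a b c" and "even (a + b)" unfolding parity_kernel_def by auto
    then have "even (a - b)" by simp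
    then obtain k where "a - b = 2 * k" by blast
    then have "h = nf 0 0 0 \<otimes> nf (b + 2 * k) b c"
      by (simp add: h nf_mult flip: \<open>a - b = 2 * k\<close>)
    moreover have "nf 0 0 0 \<in> lattice_subgroup st2_s4_lattice"
      by (rule nf_in_lattice_subgroupI) simp
    ultimately show "\<exists>i j k. \<exists>d\<in>lattice_subgroup st2_s4_lattice. h = d \<otimes> nf (i + 2 * j) i k"
      by blast
  next
    fix i j k :: int
    have "i + 2 * j + 2 * l - (i + 2 ^ n * l) = 2 * j" for l
      using assms by simp
    then show "(nf (i + 2 * j) i k \<in> lattice_subgroup st2_s4_lattice) = (int 2 dvd i \<and> int 2 dvd j \<and> int 2 dvd k)"
      unfolding nf_in_lattice_subgroup[OF lattice_pred_st2_s4] using assms by (auto elim!: dvdE)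
  qed (simp_all add: gen_in_parity_kernel nf_in_parity_kernel)
qed

lemma of_type_parity_kernel_110:
  assumes "n \<noteq> 1"
  shows "of_type (abelianization G (parity_kernel 1 1 0)) [2, 4]"
proof -
  have prod: "nf 1 1 0 [^] (i::int) \<otimes> r [^] (k::int) = nf i i k" for i k
    unfolding nf_pow by (simp add: r_pow_nf nf_mult mult.commute)
  obtain m :: int where m: "(2::int) ^ n = 2 * m" "even m"
    using two_pow assms by metis
  then obtain l where l: "m = 2 * l" by blast
  have pn: "(2::int) ^ n = 4 * l" by (simp add: m l)
  show ?thesis
  proof (rule of_type_pairI[OF subgroup_parity_kernel, of "nf 1 1 0" _ _ _ r], unfold prod derived_parity_kernel_110)
    fix h assume "h \<in> parity_kernel 1 1 0"
    then obtain a b c where h: "h = nf a b c" and "even (a + b)" unfolding parity_kernel_def by auto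
    then have "even (a - b)" by simp
    then obtain k where "a - b = 2 * k" by blast
    then have a: "a = b + 2 * k" by simp
    have "h = nf 0 (- (2 ^ n) * k) 0 \<otimes> nf b b (c + 2 * k)"
      unfolding nf_add_even by (simp add: h a nf_mult)
    moreover have "nf 0 (- (2 ^ n) * k) 0 \<in> lattice_subgroup st2_s4_lattice"
      unfolding pn by (rule nf_in_lattice_subgroupI) simp
    ultimately show "\<exists>i j. \<exists>d\<in>lattice_subgroup st2_s4_lattice. h = d \<otimes> nf i i j"
      by blast
  next
    fix i k :: int
    have "4 dvd i + 2 * x - (i + 2 ^ n * x) \<longleftrightarrow> even x" for x
    proof -
      have "i + 2 * x - (i + 2 ^ n * x) = 2 * x - 4 * (l * x)" by (simp add: pn)
      then show ?thesis by presburger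
    qed
    then show "(nf i i k \<in> lattice_subgroup st2_s4_lattice) = (int 2 dvd i \<and> int 4 dvd k)"
      unfolding nf_in_lattice_subgroup[OF lattice_pred_st2_s4] using dvd_two_pow(2) by (auto elim!: dvdE)
  qed (simp_all add: gen_in_parity_kernel nf_in_parity_kernel)
qed


section \<open>Four of the seven subgroups\<close>

lemma subgroup_s_t:
  defines "H \<equiv> generate G {s, t}"
  shows "parity_set H \<and> s \<in> H \<and> t \<in> H \<and> r \<notin> H"
    and "derived G H = generate G {\<one>}"
    and "of_type (abelianization G H) [2 ^ 2, 2 ^ (n + 2)]"
proof -
  have H: "H = parity_kernel 0 0 1"
    unfolding H_def by (rule generate_s_t)
  show "parity_set H \<and> s \<in> H \<and> t \<in> H \<and> r \<notin> H"
    unfolding H gen_in_parity_kernel using parity_set_parity_kernel by simp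
  have "generate G {\<one>} = {\<one>}"
    by (metis generate_empty generate_one)
  then show "derived G H = generate G {\<one>}"
    unfolding H derived_parity_kernel_001 by simp
  show "of_type (abelianization G H) [2 ^ 2, 2 ^ (n + 2)]"
    unfolding H by (rule of_type_parity_kernel_001)
qed

lemma subgroup_s_t2_r:
  defines "H \<equiv> if n = 1 then generate G {s, r} else generate G {s, t [^] (2::nat), r}"
  shows "parity_set H \<and> s \<in> H \<and> t \<notin> H \<and> r \<in> H"
    and "if n = 1
         then derived G H = generate G {s [^] (2::nat)} \<and> of_type (abelianization G H) [2, 4]
         else derived G H = generate G {s [^] (2::nat), t [^] (4::nat)} \<and>
              of_type (abelianization G H) [2, 2, 2]"
proof -
  have H: "H = parity_kernel 0 1 0"
    unfolding H_def using generate_s_r generate_s_t2_r by simp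
  show "parity_set H \<and> s \<in> H \<and> t \<notin> H \<and> r \<in> H"
    unfolding H gen_in_parity_kernel using parity_set_parity_kernel by simp
  have "derived G H = generate G {s [^] (2::nat)}" if "n = 1"
    unfolding H
  proof (rule derived_parity_kernel_010_generate(2))
    show s2: "nf 2 0 0 \<in> generate G {s [^] (2::nat)}"
      by (auto simp: nat_pow_nf intro: generate.incl)
    have "nf 0 4 0 = nf 4 0 0"
      by (rule nf_eqI[where j = 1]) (simp_all add: that)
    then show "nf 0 4 0 \<in> generate G {s [^] (2::nat)}"
      using nf_pow_mem[OF generate_is_subgroup s2, of 2] by simp
  qed (simp add: nat_pow_nf)
  moreover have "derived G H = generate G {s [^] (2::nat), t [^] (4::nat)}"
    unfolding H by (rule derived_parity_kernel_010_generate(2)) (auto simp: nat_pow_nf intro: generate.incl)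
  ultimately show "if n = 1
         then derived G H = generate G {s [^] (2::nat)} \<and> of_type (abelianization G H) [2, 4]
         else derived G H = generate G {s [^] (2::nat), t [^] (4::nat)} \<and>
              of_type (abelianization G H) [2, 2, 2]"
    using of_type_parity_kernel_010_n1 of_type_parity_kernel_010 unfolding H by simp
qed

lemma subgroup_r_t:
  defines "H \<equiv> generate G {r, t}"
  shows "parity_set H \<and> s \<notin> H \<and> t \<in> H \<and> r \<in> H"
    and "derived G H = generate G {t [^] (2::nat)}" and "of_type (abelianization G H) [2, 4]"
proof -
  have H: "H = parity_kernel 1 0 0"
    unfolding H_def by (rule generate_r_t)
  show "parity_set H \<and> s \<notin> H \<and> t \<in> H \<and> r \<in> H"
    unfolding H gen_in_parity_kernel using parity_set_parity_kernel by simp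
  show "derived G H = generate G {t [^] (2::nat)}"
    unfolding H by (rule derived_parity_kernel_100_generate(2)) (auto simp: nat_pow_nf intro: generate.incl)
  show "of_type (abelianization G H) [2, 4]"
    unfolding H by (rule of_type_parity_kernel_100)
qed

lemma st_pow_nf: "(s \<otimes> t) [^] (2::nat) = nf 2 2 0"
  using nf_pow[of 1 1 "int 2"] unfolding int_pow_int by (simp add: st_nf)

lemma subgroup_st_r:
  defines "H \<equiv> if n = 1 then generate G {s \<otimes> t, r, s [^] (2::nat)} else generate G {s \<otimes> t, r}"
  shows "parity_set H \<and> s \<notin> H \<and> t \<notin> H \<and> r \<in> H"
    and "if n = 1
         then derived G H = generate G {(s \<otimes> t) [^] (2::nat), s [^] (4::nat)} \<and>
              of_type (abelianization G H) [2, 2, 2]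
         else derived G H = generate G {(s \<otimes> t) [^] (2::nat)} \<and>
              of_type (abelianization G H) [2, 4]"
proof -
  have H: "H = parity_kernel 1 1 0"
    unfolding H_def using generate_st_r generate_st_r_s2 by simp
  show "parity_set H \<and> s \<notin> H \<and> t \<notin> H \<and> r \<in> H"
    unfolding H gen_in_parity_kernel using parity_set_parity_kernel by simp
  have "derived G H = generate G {(s \<otimes> t) [^] (2::nat), s [^] (4::nat)}"
    unfolding H by (rule derived_parity_kernel_110_generate(2)) (auto simp: nat_pow_nf st_pow_nf intro: generate.incl)
  moreover have "derived G H = generate G {(s \<otimes> t) [^] (2::nat)}" if "n \<noteq> 1"
    unfolding H
  proof (rule derived_parity_kernel_110_generate(2))
    show st: "nf 2 2 0 \<in> generate G {(s \<otimes> t) [^] (2::nat)}"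
      by (auto simp: st_pow_nf intro: generate.incl)
    show "nf 4 0 0 \<in> generate G {(s \<otimes> t) [^] (2::nat)}"
      using nf_pow_mem[OF generate_is_subgroup st, of "2 ^ n"] st_pow[OF that] by simp
  qed (simp add: st_pow_nf)
  ultimately show "if n = 1
         then derived G H = generate G {(s \<otimes> t) [^] (2::nat), s [^] (4::nat)} \<and>
              of_type (abelianization G H) [2, 2, 2]
         else derived G H = generate G {(s \<otimes> t) [^] (2::nat)} \<and>
              of_type (abelianization G H) [2, 4]"
    using of_type_parity_kernel_110_n1 of_type_parity_kernel_110 unfolding H by simp
qed


section \<open>Substitutions preserving the relations\<close>

lemma generated_by:
  assumes "S \<subseteq> carrier G" "s \<in> generate G S" "t \<in> generate G S" "r \<in> generate G S"
  shows "carrier G = generate G S"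
proof (rule subset_antisym)
  have "generate G {s, t, r} \<subseteq> generate G S"
    using assms by (intro generate_subgroup_incl generate_is_subgroup) auto
  then show "carrier G \<subseteq> generate G S"
    using generated by simp
qed (rule generate_incl[OF assms(1)])

text \<open>
  The element \<open>\<tau>\<rho>\<close> acts on \<open>\<langle>\<sigma>, \<tau>\<rangle>\<close> as \<open>\<rho>\<close> does, and \<open>(\<tau>\<rho>)\<^sup>2 = \<tau> \<tau>\<inverse> \<rho>\<^sup>2 = \<rho>\<^sup>2\<close>.
\<close>

lemma Gn_group_t_r: "Gn_group G n s t (t \<otimes> r)"
proof unfold_locales
  have tr: "t \<otimes> r = nf 0 1 1" and s1: "nf 1 0 0 = s" and t1: "nf 0 1 0 = t"
    by (simp_all add: nf_def)
  show "carrier G = generate G {s, t, t \<otimes> r}"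
  proof (rule generated_by)
    have mem: "inv t \<in> generate G {s, t, t \<otimes> r}" "t \<otimes> r \<in> generate G {s, t, t \<otimes> r}"
      by (auto intro: generate.incl generate.inv)
    have "inv t \<otimes> (t \<otimes> r) \<in> generate G {s, t, t \<otimes> r}"
      using mem by (rule generate.eng)
    then show "r \<in> generate G {s, t, t \<otimes> r}"
      by (simp add: m_assoc[symmetric])
  qed (auto intro: generate.incl)
  have "(t \<otimes> r) [^] (2::int) = nf 0 1 1 \<otimes> nf 0 1 1"
    unfolding tr using int_pow_mult[OF nf_closed, of 0 1 1 1 1] by simp
  also have "\<dots> = r [^] (2::int)"
    by (simp add: nf_mult r_pow_nf)
  finally show "(t \<otimes> r) [^] (2::int) = t [^] ((2::int) ^ n) \<otimes> s [^] (2::int)"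
    using r2 by simp
  have "nf 0 1 1 \<otimes> nf 1 0 0 = nf 3 0 0 \<otimes> nf 0 1 1"
    by (simp add: nf_mult)
  then show "t \<otimes> r \<otimes> s = s [^] (3::int) \<otimes> (t \<otimes> r)"
    by (simp only: tr s1 s_pow_nf)
  have "nf 0 1 1 \<otimes> nf 0 1 0 = nf 0 (-1) 0 \<otimes> nf 0 1 1"
    by (simp add: nf_mult)
  then show "t \<otimes> r \<otimes> t = t [^] (-1::int) \<otimes> (t \<otimes> r)"
    by (simp only: tr t1 t_pow_nf)
  show "t \<otimes> r \<noteq> s [^] a \<otimes> t [^] b" for a b :: int
  proof
    assume "t \<otimes> r = s [^] a \<otimes> t [^] b"
    then have "nf 0 1 1 = nf a b 0"
      unfolding tr by (simp add: s_pow_nf t_pow_nf nf_mult)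
    then show False
      by (rule nf_eqD) presburger
  qed
qed (use n s4 s8 ts faithful in auto)

text \<open>
  Here \<open>(\<sigma>\<rho>)\<^sup>2 = \<sigma>\<^sup>4 \<rho>\<^sup>2 = \<tau>\<^bsup>2^n\<^esup> \<sigma>\<^sup>6 = \<tau>\<^bsup>2^n\<^esup> \<sigma>\<^bsup>-2\<^esup>\<close>, so inverting \<open>\<sigma>\<close> restores the relation for the square.
\<close>

lemma Gn_group_inv_s: "Gn_group G n (inv s) t (s \<otimes> r)"
proof unfold_locales
  have sr: "s \<otimes> r = nf 1 0 1" and s1: "nf (-1) 0 0 = inv s" and t1: "nf 0 1 0 = t"
    by (simp_all add: nf_def int_pow_neg)
  have pow: "inv s [^] k = nf (- k) 0 0" for k :: int
    by (simp add: s_pow_nf[symmetric] int_pow_inv int_pow_neg)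
  show "carrier G = generate G {inv s, t, s \<otimes> r}"
  proof (rule generated_by)
    have mem: "inv s \<in> generate G {inv s, t, s \<otimes> r}" "s \<otimes> r \<in> generate G {inv s, t, s \<otimes> r}"
      by (auto intro: generate.incl)
    have "inv s \<otimes> (s \<otimes> r) \<in> generate G {inv s, t, s \<otimes> r}"
      using mem by (rule generate.eng)
    then show "r \<in> generate G {inv s, t, s \<otimes> r}"
      by (simp add: m_assoc[symmetric])
    have "inv (inv s) \<in> generate G {inv s, t, s \<otimes> r}"
      by (rule generate.inv) simp
    then show "s \<in> generate G {inv s, t, s \<otimes> r}"
      by simp
  qed (auto intro: generate.incl)
  show "inv s [^] (4::int) = t [^] ((2::int) ^ (n + 1))"
    unfolding pow t_pow_nf by (rule nf_eqI[where j = "-1"]) simp_all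
  have "nf (-8) 0 0 = nf 0 0 0"
    by (rule nf_eqI[where j = 0]) simp_all
  then show "inv s [^] (8::int) = \<one>"
    unfolding pow nf_one .
  have "(s \<otimes> r) [^] (2::int) = nf 1 0 1 \<otimes> nf 1 0 1"
    unfolding sr using int_pow_mult[OF nf_closed, of 1 0 1 1 1] by simp
  also have "\<dots> = nf 4 0 (2 * 1)"
    by (simp add: nf_mult)
  also have "\<dots> = nf (-2) (2 ^ n) 0"
    unfolding nf_even by (rule nf_eqI[where j = 0]) simp_all
  also have "\<dots> = t [^] ((2::int) ^ n) \<otimes> inv s [^] (2::int)"
    unfolding pow t_pow_nf by (simp add: nf_mult)
  finally show "(s \<otimes> r) [^] (2::int) = t [^] ((2::int) ^ n) \<otimes> inv s [^] (2::int)" .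
  have "nf 0 1 0 \<otimes> nf (-1) 0 0 = nf (-1) 0 0 \<otimes> nf 0 1 0"
    by (simp add: nf_mult)
  then show "t \<otimes> inv s = inv s \<otimes> t"
    by (simp only: s1 t1)
  have "nf 1 0 1 \<otimes> nf (-1) 0 0 = nf (-3) 0 0 \<otimes> nf 1 0 1"
    by (simp add: nf_mult)
  then show "s \<otimes> r \<otimes> inv s = inv s [^] (3::int) \<otimes> (s \<otimes> r)"
    unfolding pow by (simp only: sr s1)
  have "nf 1 0 1 \<otimes> nf 0 1 0 = nf 0 (-1) 0 \<otimes> nf 1 0 1"
    by (simp add: nf_mult)
  then show "s \<otimes> r \<otimes> t = t [^] (-1::int) \<otimes> (s \<otimes> r)"
    by (simp only: sr t1 t_pow_nf)
  show "\<exists>j. b = 2 ^ (n + 1) * j \<and> 8 dvd a - 4 * j" if "inv s [^] a \<otimes> t [^] b = \<one>" for a b :: int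
  proof -
    have "nf (- a) b 0 = \<one>"
      using that unfolding pow t_pow_nf by (simp add: nf_mult)
    then obtain j where "b = 2 ^ (n + 1) * j" "8 dvd - a - 4 * j"
      unfolding nf_eq_one by blast
    moreover from this(2) have "8 dvd a - 4 * j" by presburger
    ultimately show ?thesis by blast
  qed
  show "s \<otimes> r \<noteq> inv s [^] a \<otimes> t [^] b" for a b :: int
  proof
    assume "s \<otimes> r = inv s [^] a \<otimes> t [^] b"
    then have "nf 1 0 1 = nf (- a) b 0"
      unfolding sr pow by (simp add: t_pow_nf nf_mult)
    then show False
      by (rule nf_eqD) presburger
  qed
qed (use n in auto)


section \<open>Counting the subgroups of index two\<close>

text \<open>
  A parity set is determined by the generators it contains, and the seven patterns listed are all
  except the one that belongs to the whole group.
\<close>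

lemma index_2_subgroups:
  fixes H :: "nat \<Rightarrow> 'a set"
  defines "bits \<equiv> \<lambda>K. (s \<in> K, t \<in> K, r \<in> K)"
  assumes par: "\<And>i. i \<in> {1..7} \<Longrightarrow> parity_set (H i)"
    and bits: "bits (H 1) = (True, True, False)" "bits (H 2) = (True, False, True)"
      "bits (H 3) = (False, True, True)" "bits (H 4) = (False, False, True)"
      "bits (H 5) = (False, True, False)" "bits (H 6) = (True, False, False)"
      "bits (H 7) = (False, False, False)"
  shows "{K. subgroup K G \<and> card (rcosets K) = 2} = H ` {1..7}"
    and "card {K. subgroup K G \<and> card (rcosets K) = 2} = 7"
proof -
  have seven: "{1..7::nat} = {1, 2, 3, 4, 5, 6, 7}"
    by auto
  have eqI: "K = L" if "parity_set K" "parity_set L" "bits K = bits L" for K L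
    using that by (intro parity_set_eqI[OF _ _ generated]) (auto simp: bits_def)
  have carrier: "parity_set (carrier G)" "bits (carrier G) = (True, True, True)"
    by (simp_all add: parity_set_def bits_def)
  show eq: "{K. subgroup K G \<and> card (rcosets K) = 2} = H ` {1..7}"
    unfolding index_2_iff_parity_set
  proof (intro equalityI subsetI)
    fix K assume "K \<in> {K. parity_set K \<and> K \<noteq> carrier G}"
    then have K: "parity_set K" "bits K \<noteq> (True, True, True)"
      using eqI[OF _ carrier(1)] carrier(2) by auto
    obtain x y z where xyz: "bits K = (x, y, z)"
      by (rule prod_cases3)
    then have "\<exists>i\<in>{1..7}. bits K = bits (H i)"
      using K(2) unfolding seven
      by (cases x; cases y; cases z) (simp_all add: bits del: One_nat_def)
    then obtain i where "i \<in> {1..7}" "bits K = bits (H i)" ..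
    with eqI[OF K(1) par] show "K \<in> H ` {1..7}" by blast
  next
    fix K assume "K \<in> H ` {1..7}"
    then obtain i where i: "i \<in> {1..7}" "K = H i" by blast
    have "bits (H i) \<noteq> (True, True, True)"
      using i(1) bits unfolding seven by auto
    then show "K \<in> {K. parity_set K \<and> K \<noteq> carrier G}"
      using par i carrier(2) by auto
  qed
  have "inj_on (bits \<circ> H) {1..7}"
    unfolding seven by (simp add: bits del: One_nat_def)
  then have "inj_on H {1..7}"
    by (rule inj_on_imageI2)
  then show "card {K. subgroup K G \<and> card (rcosets K) = 2} = 7"
    unfolding eq by (simp add: card_image)
qed

end


section \<open>A faithful model of the presentation\<close>

text \<open>
  With \<open>M = 2\<^bsup>n+1\<^esup>\<close>, the triple \<open>(a, b, c)\<close> stands for \<open>\<epsilon>\<^sup>a \<tau>\<^sup>b \<rho>\<^sup>c\<close>, where \<open>\<epsilon> = \<sigma> \<tau>\<^bsup>-M/4\<^esup>\<close> has order 4. In these coordinates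
  \<open>\<langle>\<sigma>, \<tau>\<rangle>\<close> is a direct product, \<open>\<rho>\<close> acts by \<open>(a, b) \<mapsto> (-a, Ma - b)\<close>, and \<open>\<rho>\<^sup>2 = \<epsilon>\<^sup>2 \<tau>\<^sup>M\<close>, which explains the terms
  containing \<open>c\<close> in the multiplication.
\<close>

definition Gn_model :: "int \<Rightarrow> (int \<times> int \<times> int) monoid" where
  "Gn_model M = \<lparr>carrier = {0..<4} \<times> {0..<2 * M} \<times> {0..<2},
     monoid.mult = (\<lambda>(a, b, c) (a', b', c'). ((a + (1 - 2 * c) * a' + 2 * c * c') mod 4,
       (b + (1 - 2 * c) * b' + M * c * (a' + c')) mod (2 * M), (c + c') mod 2)),
     one = (0, 0, 0)\<rparr>"

definition triple :: "int \<Rightarrow> int \<Rightarrow> int \<Rightarrow> int \<Rightarrow> int \<times> int \<times> int" where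
  "triple M a b c = (a mod 4, b mod (2 * M), c mod 2)"

lemma mod_eq_witness: "x mod N = y mod N" if "x - y = N * k" for x y N k :: int
  using that by (simp add: mod_eq_dvd_iff)

lemma triple_eqI:
  assumes "a - a' = 4 * i" "b - b' = 2 * M * j"
  shows "triple M a b c = triple M a' b' c"
  unfolding triple_def using mod_eq_witness[OF assms(1)] mod_eq_witness[OF assms(2)] by simp

text \<open>
  On representatives with \<open>c, c' \<in> {0, 1}\<close> addition modulo 2 is the polynomial \<open>c + c' - 2cc'\<close>. Multiplication is thus
  polynomial, and associativity becomes an identity of integer polynomials up to explicit multiples of the moduli.
\<close>

lemma mult_triple:
  assumes c: "c \<in> {0, 1}" "c' \<in> {0, 1}"
  shows "triple M a b c \<otimes>\<^bsub>Gn_model M\<^esub> triple M a' b' c' =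
    triple M (a + (1 - 2 * c) * a' + 2 * c * c') (b + (1 - 2 * c) * b' + M * c * (a' + c'))
      (c + c' - 2 * c * c')"
proof -
  have m: "\<exists>p. x mod N = x - N * p" for x N :: int
    by (metis minus_mult_div_eq_mod)
  obtain p q where p: "a mod 4 = a - 4 * p" and q: "a' mod 4 = a' - 4 * q"
    using m by metis
  obtain u v where u: "b mod (2 * M) = b - 2 * M * u" and v: "b' mod (2 * M) = b' - 2 * M * v"
    using m by metis
  have "(a mod 4 + (1 - 2 * c) * (a' mod 4) + 2 * c * c') mod 4 =
      (a + (1 - 2 * c) * a' + 2 * c * c') mod 4"
    unfolding p q by (rule mod_eq_witness[where k = "- p - (1 - 2 * c) * q"]) (simp add: algebra_simps)
  moreover have "(b mod (2 * M) + (1 - 2 * c) * (b' mod (2 * M)) + M * c * (a' mod 4 + c')) mod (2 * M) =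
      (b + (1 - 2 * c) * b' + M * c * (a' + c')) mod (2 * M)"
    unfolding q u v
    by (rule mod_eq_witness[where k = "- u - (1 - 2 * c) * v - 2 * c * q"]) (simp add: algebra_simps)
  moreover have "c mod 2 = c" "c' mod 2 = c'" "(c + c') mod 2 = (c + c' - 2 * c * c') mod 2"
    using c by auto
  ultimately show ?thesis
    unfolding Gn_model_def triple_def by (simp only: prod.case monoid.select_convs)
qed

lemma triple_closed: "M > 0 \<Longrightarrow> triple M a b c \<in> carrier (Gn_model M)"
  by (simp add: Gn_model_def triple_def)

lemma carrier_Gn_model:
  assumes "x \<in> carrier (Gn_model M)"
  obtains a b c where "x = triple M a b c" "c \<in> {0, 1}"
proof -
  obtain a b c where x: "x = (a, b, c)" by (rule prod_cases3)
  with assms have "a \<in> {0..<4}" "b \<in> {0..<2 * M}" "c \<in> {0..<2}"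
    by (auto simp: Gn_model_def)
  then have "x = triple M a b c" "c \<in> {0, 1}"
    unfolding x triple_def by auto
  then show thesis by (rule that)
qed

lemma one_Gn_model: "\<one>\<^bsub>Gn_model M\<^esub> = triple M 0 0 0"
  by (simp add: Gn_model_def triple_def)

lemma group_Gn_model:
  assumes M: "M > 0"
  shows "group (Gn_model M)"
proof (rule groupI)
  have xor: "c + c' - 2 * c * c' \<in> {0, 1}" if "c \<in> {0, 1}" "c' \<in> {0, 1}" for c c' :: int
    using that by auto
  show "x \<otimes>\<^bsub>Gn_model M\<^esub> y \<in> carrier (Gn_model M)" if xy: "x \<in> carrier (Gn_model M)" "y \<in> carrier (Gn_model M)" for x y
  proof -
    obtain a b c where x: "x = triple M a b c" "c \<in> {0, 1}"
      using xy(1) by (rule carrier_Gn_model)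
    obtain a' b' c' where y: "y = triple M a' b' c'" "c' \<in> {0, 1}"
      using xy(2) by (rule carrier_Gn_model)
    show ?thesis
      unfolding x(1) y(1) mult_triple[OF x(2) y(2)] by (rule triple_closed[OF M])
  qed
  show "\<one>\<^bsub>Gn_model M\<^esub> \<in> carrier (Gn_model M)"
    unfolding one_Gn_model by (rule triple_closed[OF M])
  show "x \<otimes>\<^bsub>Gn_model M\<^esub> y \<otimes>\<^bsub>Gn_model M\<^esub> z = x \<otimes>\<^bsub>Gn_model M\<^esub> (y \<otimes>\<^bsub>Gn_model M\<^esub> z)"
    if xy: "x \<in> carrier (Gn_model M)" "y \<in> carrier (Gn_model M)" "z \<in> carrier (Gn_model M)" for x y z
  proof -
    obtain a b c where x: "x = triple M a b c" "c \<in> {0, 1}"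
      using xy(1) by (rule carrier_Gn_model)
    obtain a' b' c' where y: "y = triple M a' b' c'" "c' \<in> {0, 1}"
      using xy(2) by (rule carrier_Gn_model)
    obtain a'' b'' c'' where z: "z = triple M a'' b'' c''" "c'' \<in> {0, 1}"
      using xy(3) by (rule carrier_Gn_model)
    have c: "c + c' - 2 * c * c' + c'' - 2 * (c + c' - 2 * c * c') * c'' =
        c + (c' + c'' - 2 * c' * c'') - 2 * c * (c' + c'' - 2 * c' * c'')"
      by (simp add: algebra_simps)
    show ?thesis
      unfolding x(1) y(1) z(1) mult_triple[OF x(2) y(2)] mult_triple[OF y(2) z(2)]
        mult_triple[OF xor[OF x(2) y(2)] z(2)] mult_triple[OF x(2) xor[OF y(2) z(2)]] c
      \<comment> \<open>The difference of the two sides, divided by the moduli 4 and \<open>2M\<close>.\<close>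
      by (rule triple_eqI[where i = "c * c' * c''" and j = "c * c' * a''"])
         (simp_all add: algebra_simps)
  qed
  show "\<one>\<^bsub>Gn_model M\<^esub> \<otimes>\<^bsub>Gn_model M\<^esub> x = x" if "x \<in> carrier (Gn_model M)" for x
    using that
  proof (rule carrier_Gn_model)
    fix a b c assume "x = triple M a b c" "c \<in> {0, 1}"
    then show ?thesis using mult_triple[of 0 c M 0 0 a b] by (simp add: one_Gn_model)
  qed
  show "\<exists>y\<in>carrier (Gn_model M). y \<otimes>\<^bsub>Gn_model M\<^esub> x = \<one>\<^bsub>Gn_model M\<^esub>" if x: "x \<in> carrier (Gn_model M)" for x
    using x
  proof (rule carrier_Gn_model)
    fix a b c assume x: "x = triple M a b c" "c \<in> {0, 1}"
    let ?y = "triple M ((2 * c - 1) * a - 2 * c) ((2 * c - 1) * b - M * c * (a + c)) c"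
    have "?y \<otimes>\<^bsub>Gn_model M\<^esub> x = \<one>\<^bsub>Gn_model M\<^esub>"
      unfolding x(1) mult_triple[OF x(2) x(2)] one_Gn_model using x(2) by auto
    then show ?thesis using triple_closed[OF M] by blast
  qed
qed

lemma triple_pow:
  assumes M: "M > 0"
  shows "triple M a b 0 [^]\<^bsub>Gn_model M\<^esub> (k::int) = triple M (k * a) (k * b) 0"
proof -
  interpret group "Gn_model M" by (rule group_Gn_model[OF M])
  have nat: "triple M a b 0 [^]\<^bsub>Gn_model M\<^esub> k = triple M (int k * a) (int k * b) 0" for k :: nat
    by (induction k) (simp_all add: one_Gn_model mult_triple algebra_simps)
  show ?thesis
  proof (cases k rule: int_cases2)
    case (nonneg k)
    then show ?thesis using nat by (simp add: int_pow_int)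
  next
    case (nonpos j)
    have "inv\<^bsub>Gn_model M\<^esub> (triple M (int j * a) (int j * b) 0) = triple M (k * a) (k * b) 0"
      by (rule inv_equality) (simp_all add: mult_triple one_Gn_model triple_closed M nonpos)
    then show ?thesis
      unfolding nonpos using nat by (simp add: int_pow_neg_int triple_closed M)
  qed
qed

lemma (in group) commutator_eq_iff:
  assumes "x \<in> carrier G" "y \<in> carrier G" "z \<in> carrier G"
  shows "commutator G x y = z \<longleftrightarrow> x \<otimes> y = y \<otimes> x \<otimes> z"
proof -
  have "commutator G x y = inv (y \<otimes> x) \<otimes> (x \<otimes> y)"
    unfolding commutator_def using assms by (simp add: inv_mult_group m_assoc)
  then show ?thesis
    using assms inv_solve_left'[of z "y \<otimes> x" "x \<otimes> y"] by auto
qed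

lemma (in group_hom) hom_commutator:
  "x \<in> carrier G \<Longrightarrow> y \<in> carrier G \<Longrightarrow> h (commutator G x y) = commutator H (h x) (h y)"
  by (simp add: commutator_def)

lemma Gn_relations_closed: "Gn_relations n \<subseteq> carrier free_group \<times> carrier free_group"
proof -
  interpret F: group "free_group :: gen word set monoid" by (rule group_free_group)
  show ?thesis
    by (auto simp: Gn_relations_def Let_def commutator_def free_gen_closed)
qed

definition satisfies_Gn_relations :: "('a, 'b) monoid_scheme \<Rightarrow> nat \<Rightarrow> 'a \<Rightarrow> 'a \<Rightarrow> 'a \<Rightarrow> bool" where
  "satisfies_Gn_relations G n s t r \<longleftrightarrow>
     r [^]\<^bsub>G\<^esub> (4::nat) = \<one>\<^bsub>G\<^esub> \<and> s [^]\<^bsub>G\<^esub> (8::nat) = \<one>\<^bsub>G\<^esub> \<and> t [^]\<^bsub>G\<^esub> ((2::nat) ^ (n + 2)) = \<one>\<^bsub>G\<^esub> \<and>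
     s [^]\<^bsub>G\<^esub> (4::nat) = t [^]\<^bsub>G\<^esub> ((2::nat) ^ (n + 1)) \<and>
     r [^]\<^bsub>G\<^esub> (2::nat) = t [^]\<^bsub>G\<^esub> ((2::nat) ^ n) \<otimes>\<^bsub>G\<^esub> s [^]\<^bsub>G\<^esub> (2::nat) \<and>
     commutator G t s = \<one>\<^bsub>G\<^esub> \<and> commutator G r s = s [^]\<^bsub>G\<^esub> (-2::int) \<and>
     commutator G r t = t [^]\<^bsub>G\<^esub> (2::nat)"

lemma satisfies_Gn_relations_iff:
  assumes "group_hom free_group G \<phi>"
  shows "satisfies_Gn_relations G n (\<phi> (free_gen Gen_sigma)) (\<phi> (free_gen Gen_tau)) (\<phi> (free_gen Gen_rho)) \<longleftrightarrow>
    (\<forall>(u, v)\<in>Gn_relations n. \<phi> u = \<phi> v)"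
proof -
  interpret group_hom free_group G \<phi> by (rule assms)
  show ?thesis
    unfolding satisfies_Gn_relations_def Gn_relations_def Let_def
    by (simp add: hom_nat_pow hom_int_pow hom_commutator free_gen_closed)
qed

lemma Gn_model_satisfies:
  assumes m: "(2::int) ^ n = 2 * m" "m > 0"
  shows "satisfies_Gn_relations (Gn_model (4 * m)) n (triple (4 * m) 1 m 0) (triple (4 * m) 0 1 0) (triple (4 * m) 0 0 1)"
proof -
  let ?M = "4 * m"
  have M: "?M > 0" using m by simp
  interpret group "Gn_model ?M" by (rule group_Gn_model[OF M])
  have pow: "triple ?M a b 0 [^]\<^bsub>Gn_model ?M\<^esub> k = triple ?M (int k * a) (int k * b) 0" for a b and k :: nat
    using triple_pow[OF M, of a b "int k"] by (simp add: int_pow_int)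
  have closed [simp]: "triple ?M a b c \<in> carrier (Gn_model ?M)" for a b c
    by (rule triple_closed[OF M])
  have r2: "triple ?M 0 0 1 [^]\<^bsub>Gn_model ?M\<^esub> (2::nat) = triple ?M 2 ?M 0"
    by (simp add: numeral_2_eq_2 mult_triple)
  have "triple ?M 0 0 1 [^]\<^bsub>Gn_model ?M\<^esub> (2 * 2::nat) = triple ?M 4 (2 * ?M) 0"
    unfolding nat_pow_pow[OF closed, symmetric] r2 pow by simp
  also have "\<dots> = \<one>\<^bsub>Gn_model ?M\<^esub>"
    unfolding one_Gn_model by (rule triple_eqI[where i = 1 and j = 1]) simp_all
  finally have "triple ?M 0 0 1 [^]\<^bsub>Gn_model ?M\<^esub> (4::nat) = \<one>\<^bsub>Gn_model ?M\<^esub>" by simp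
  moreover have "triple ?M 1 m 0 [^]\<^bsub>Gn_model ?M\<^esub> (8::nat) = \<one>\<^bsub>Gn_model ?M\<^esub>"
    unfolding pow one_Gn_model by (rule triple_eqI[where i = 2 and j = 1]) simp_all
  moreover have "triple ?M 0 1 0 [^]\<^bsub>Gn_model ?M\<^esub> ((2::nat) ^ (n + 2)) = \<one>\<^bsub>Gn_model ?M\<^esub>"
    unfolding pow one_Gn_model by (rule triple_eqI[where i = 0 and j = 1]) (simp_all add: m)
  moreover have "triple ?M 1 m 0 [^]\<^bsub>Gn_model ?M\<^esub> (4::nat) = triple ?M 0 1 0 [^]\<^bsub>Gn_model ?M\<^esub> ((2::nat) ^ (n + 1))"
    unfolding pow by (rule triple_eqI[where i = 1 and j = 0]) (simp_all add: m)
  moreover have "triple ?M 0 0 1 [^]\<^bsub>Gn_model ?M\<^esub> (2::nat) =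
      triple ?M 0 1 0 [^]\<^bsub>Gn_model ?M\<^esub> ((2::nat) ^ n) \<otimes>\<^bsub>Gn_model ?M\<^esub> triple ?M 1 m 0 [^]\<^bsub>Gn_model ?M\<^esub> (2::nat)"
    unfolding r2 pow by (simp add: mult_triple m)
  moreover have "commutator (Gn_model ?M) (triple ?M 0 1 0) (triple ?M 1 m 0) = \<one>\<^bsub>Gn_model ?M\<^esub>"
    by (subst commutator_eq_iff) (simp_all add: mult_triple one_Gn_model add.commute)
  moreover have "commutator (Gn_model ?M) (triple ?M 0 0 1) (triple ?M 1 m 0) = triple ?M 1 m 0 [^]\<^bsub>Gn_model ?M\<^esub> (-2::int)"
    unfolding triple_pow[OF M]
    by (subst commutator_eq_iff)
       (simp_all add: mult_triple, rule triple_eqI[where i = "-1" and j = 1], simp_all)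
  moreover have "commutator (Gn_model ?M) (triple ?M 0 0 1) (triple ?M 0 1 0) = triple ?M 0 1 0 [^]\<^bsub>Gn_model ?M\<^esub> (2::nat)"
    unfolding pow by (subst commutator_eq_iff) (simp_all add: mult_triple)
  ultimately show ?thesis
    unfolding satisfies_Gn_relations_def by blast
qed

lemma Gn_hom:
  assumes M: "group M" and c: "s \<in> carrier M" "t \<in> carrier M" "r \<in> carrier M"
    and rel: "satisfies_Gn_relations M n s t r"
  obtains h where "h \<in> hom (Gn n) M" "h (Gn_sigma n) = s" "h (Gn_tau n) = t" "h (Gn_rho n) = r"
proof -
  define f where "f = case_gen s t r"
  have "range f \<subseteq> carrier M"
    using c by (auto simp: f_def split: gen.split)
  with group.free_group_hom[OF M] obtain \<phi> where \<phi>: "\<phi> \<in> hom free_group M" "\<And>x. \<phi> (free_gen x) = f x"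
    by metis
  have "group_hom free_group M \<phi>"
    by (simp add: group_hom_def group_hom_axioms_def M \<phi> group_free_group)
  from satisfies_Gn_relations_iff[OF this, of n] rel
  have "\<phi> u = \<phi> v" if "(u, v) \<in> Gn_relations n" for u v
    using that by (auto simp: \<phi> f_def)
  then obtain h where "h \<in> hom (presented_group (Gn_relations n)) M"
    "\<And>x. h (presented_gen (Gn_relations n) x) = \<phi> (free_gen x)"
    using presented_group_hom[OF Gn_relations_closed M \<phi>(1)] by metis
  then show thesis
    by (intro that[of h]) (simp_all add: Gn_def Gn_sigma_def Gn_tau_def Gn_rho_def \<phi> f_def)
qed

text \<open>
  The relations hold by construction. A relation \<open>\<sigma>\<^sup>a \<tau>\<^sup>b = 1\<close> or \<open>\<rho> = \<sigma>\<^sup>a \<tau>\<^sup>b\<close> in \<open>G\<^sub>n\<close> would be mapped to one in the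
  model, where it can be compared coordinatewise.
\<close>

lemma Gn_group_Gn:
  assumes n: "n \<ge> 1"
  shows "Gn_group (Gn n) n (Gn_sigma n) (Gn_tau n) (Gn_rho n)"
proof -
  interpret group "Gn n" by (rule group_Gn)
  let ?G = "Gn n" and ?s = "Gn_sigma n" and ?t = "Gn_tau n" and ?r = "Gn_rho n"
  obtain \<pi> where \<pi>: "group_hom free_group ?G \<pi>" and gens: "\<And>x. \<pi> (free_gen x) = presented_gen (Gn_relations n) x"
    and rel: "\<And>u v. (u, v) \<in> Gn_relations n \<Longrightarrow> \<pi> u = \<pi> v"
    using presented_projection[OF Gn_relations_closed[of n]] unfolding Gn_def by metis
  interpret \<pi>: group_hom free_group ?G \<pi> by (rule \<pi>)
  have gens': "\<pi> (free_gen Gen_sigma) = ?s" "\<pi> (free_gen Gen_tau) = ?t" "\<pi> (free_gen Gen_rho) = ?r"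
    by (simp_all add: gens Gn_sigma_def Gn_tau_def Gn_rho_def)
  have closed [simp]: "?s \<in> carrier ?G" "?t \<in> carrier ?G" "?r \<in> carrier ?G"
    unfolding gens'[symmetric] by (simp_all add: free_gen_closed)
  have "satisfies_Gn_relations ?G n ?s ?t ?r"
    using satisfies_Gn_relations_iff[OF \<pi>, of n] rel unfolding gens' by blast
  then have R: "?s [^]\<^bsub>?G\<^esub> (8::nat) = \<one>\<^bsub>?G\<^esub>"
    "?s [^]\<^bsub>?G\<^esub> (4::nat) = ?t [^]\<^bsub>?G\<^esub> ((2::nat) ^ (n + 1))"
    "?r [^]\<^bsub>?G\<^esub> (2::nat) = ?t [^]\<^bsub>?G\<^esub> ((2::nat) ^ n) \<otimes>\<^bsub>?G\<^esub> ?s [^]\<^bsub>?G\<^esub> (2::nat)"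
    "?t \<otimes>\<^bsub>?G\<^esub> ?s = ?s \<otimes>\<^bsub>?G\<^esub> ?t \<otimes>\<^bsub>?G\<^esub> \<one>\<^bsub>?G\<^esub>"
    "?r \<otimes>\<^bsub>?G\<^esub> ?s = ?s \<otimes>\<^bsub>?G\<^esub> ?r \<otimes>\<^bsub>?G\<^esub> ?s [^]\<^bsub>?G\<^esub> (-2::int)"
    "?r \<otimes>\<^bsub>?G\<^esub> ?t = ?t \<otimes>\<^bsub>?G\<^esub> ?r \<otimes>\<^bsub>?G\<^esub> ?t [^]\<^bsub>?G\<^esub> (2::nat)"
    unfolding satisfies_Gn_relations_def by (simp_all only: commutator_eq_iff closed one_closed nat_pow_closed int_pow_closed)
  define m where "m = (2::int) ^ (n - 1)"
  have m: "(2::int) ^ n = 2 * m" "m > 0"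
    unfolding m_def using n by (cases n, auto)
  have M: "4 * m > 0" using m by simp
  interpret M: group "Gn_model (4 * m)" by (rule group_Gn_model[OF M])
  obtain h where "h \<in> hom ?G (Gn_model (4 * m))" and h: "h ?s = triple (4 * m) 1 m 0"
    "h ?t = triple (4 * m) 0 1 0" "h ?r = triple (4 * m) 0 0 1"
    using Gn_hom[OF M.is_group _ _ _ Gn_model_satisfies[OF m]] triple_closed[OF M] by metis
  then interpret h: group_hom ?G "Gn_model (4 * m)" h
    by (simp add: group_hom_def group_hom_axioms_def M.is_group is_group)
  have hst: "h (?s [^]\<^bsub>?G\<^esub> a \<otimes>\<^bsub>?G\<^esub> ?t [^]\<^bsub>?G\<^esub> b) = triple (4 * m) a (a * m + b) 0" for a b :: int
    by (simp add: h.hom_int_pow h triple_pow[OF M] mult_triple)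
  show ?thesis
  proof unfold_locales
    show "1 \<le> n" by (rule n)
    have "UNIV = {Gen_sigma, Gen_tau, Gen_rho}"
      using gen.exhaust by auto
    then have "range (presented_gen (Gn_relations n)) = {?s, ?t, ?r}"
      unfolding Gn_sigma_def Gn_tau_def Gn_rho_def by (metis image_empty image_insert)
    then show "carrier ?G = generate ?G {?s, ?t, ?r}"
      using presented_group_generated[OF Gn_relations_closed[of n]] unfolding Gn_def by simp
    show "?s [^]\<^bsub>?G\<^esub> (4::int) = ?t [^]\<^bsub>?G\<^esub> ((2::int) ^ (n + 1))"
      using R(2) int_pow_int[of ?G ?s 4] int_pow_int[of ?G ?t "2 ^ (n + 1)"] by simp
    show s8: "?s [^]\<^bsub>?G\<^esub> (8::int) = \<one>\<^bsub>?G\<^esub>"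
      using R(1) int_pow_int[of ?G ?s 8] by simp
    show "?r [^]\<^bsub>?G\<^esub> (2::int) = ?t [^]\<^bsub>?G\<^esub> ((2::int) ^ n) \<otimes>\<^bsub>?G\<^esub> ?s [^]\<^bsub>?G\<^esub> (2::int)"
      using R(3) int_pow_int[of ?G ?r 2] int_pow_int[of ?G ?s 2] int_pow_int[of ?G ?t "2 ^ n"] by simp
    show "?t \<otimes>\<^bsub>?G\<^esub> ?s = ?s \<otimes>\<^bsub>?G\<^esub> ?t"
      using R(4) by simp
    \<comment> \<open>The relation gives \<open>\<rho>\<inverse>\<sigma>\<rho> = \<sigma>\<^sup>3\<close>; the cube of this and \<open>\<sigma>\<^sup>9 = \<sigma>\<close> give the same rule for \<open>\<rho>\<sigma>\<rho>\<inverse>\<close>.\<close>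
    have "?r \<otimes>\<^bsub>?G\<^esub> ?s [^]\<^bsub>?G\<^esub> (3::int) = (?r \<otimes>\<^bsub>?G\<^esub> ?s) \<otimes>\<^bsub>?G\<^esub> ?s [^]\<^bsub>?G\<^esub> (2::int)"
      using int_pow_mult[of ?s 1 2] by (simp add: m_assoc)
    also have "\<dots> = ?s \<otimes>\<^bsub>?G\<^esub> ?r \<otimes>\<^bsub>?G\<^esub> (?s [^]\<^bsub>?G\<^esub> (-2::int) \<otimes>\<^bsub>?G\<^esub> ?s [^]\<^bsub>?G\<^esub> (2::int))"
      unfolding R(5) by (simp add: m_assoc)
    also have "\<dots> = ?s \<otimes>\<^bsub>?G\<^esub> ?r"
      using int_pow_mult[of ?s "-2" 2] by simp
    finally have "?r \<otimes>\<^bsub>?G\<^esub> (?s [^]\<^bsub>?G\<^esub> (3::int)) [^]\<^bsub>?G\<^esub> (3::int) = ?s [^]\<^bsub>?G\<^esub> (3::int) \<otimes>\<^bsub>?G\<^esub> ?r"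
      by (intro int_pow_intertwine) simp_all
    moreover have "(?s [^]\<^bsub>?G\<^esub> (3::int)) [^]\<^bsub>?G\<^esub> (3::int) = ?s"
      using int_pow_mult[of ?s 8 1] s8 by (simp add: int_pow_pow)
    ultimately show "?r \<otimes>\<^bsub>?G\<^esub> ?s = ?s [^]\<^bsub>?G\<^esub> (3::int) \<otimes>\<^bsub>?G\<^esub> ?r"
      by simp
    have "?t \<otimes>\<^bsub>?G\<^esub> ?r \<otimes>\<^bsub>?G\<^esub> ?t [^]\<^bsub>?G\<^esub> (2::nat) = ?t \<otimes>\<^bsub>?G\<^esub> (?r \<otimes>\<^bsub>?G\<^esub> ?t) \<otimes>\<^bsub>?G\<^esub> ?t"
      by (simp add: numeral_2_eq_2 m_assoc)
    with R(6) have "?r \<otimes>\<^bsub>?G\<^esub> ?t = ?t \<otimes>\<^bsub>?G\<^esub> (?r \<otimes>\<^bsub>?G\<^esub> ?t) \<otimes>\<^bsub>?G\<^esub> ?t"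
      by (rule trans)
    then have "?r = ?t \<otimes>\<^bsub>?G\<^esub> (?r \<otimes>\<^bsub>?G\<^esub> ?t)"
      by (metis closed m_closed r_cancel)
    then have "inv\<^bsub>?G\<^esub> ?t \<otimes>\<^bsub>?G\<^esub> ?r = inv\<^bsub>?G\<^esub> ?t \<otimes>\<^bsub>?G\<^esub> (?t \<otimes>\<^bsub>?G\<^esub> (?r \<otimes>\<^bsub>?G\<^esub> ?t))"
      by simp
    then show "?r \<otimes>\<^bsub>?G\<^esub> ?t = ?t [^]\<^bsub>?G\<^esub> (-1::int) \<otimes>\<^bsub>?G\<^esub> ?r"
      by (simp add: int_pow_neg m_assoc[symmetric])
    show "\<exists>j. b = 2 ^ (n + 1) * j \<and> 8 dvd a - 4 * j"
      if "?s [^]\<^bsub>?G\<^esub> a \<otimes>\<^bsub>?G\<^esub> ?t [^]\<^bsub>?G\<^esub> b = \<one>\<^bsub>?G\<^esub>" for a b :: int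
    proof -
      have "triple (4 * m) a (a * m + b) 0 = triple (4 * m) 0 0 0"
        using hst[of a b] that by (simp add: one_Gn_model)
      then have "4 dvd a" "8 * m dvd a * m + b"
        unfolding triple_def by (auto simp: dvd_eq_mod_eq_0)
      then obtain i j where a: "a = 4 * i" and "a * m + b = 8 * m * j"
        by (auto elim!: dvdE)
      then have "b = 2 ^ (n + 1) * (2 * j - i)"
        using m by (simp add: algebra_simps)
      moreover have "8 dvd a - 4 * (2 * j - i)"
        unfolding a by presburger
      ultimately show ?thesis by blast
    qed
    show "?r \<noteq> ?s [^]\<^bsub>?G\<^esub> a \<otimes>\<^bsub>?G\<^esub> ?t [^]\<^bsub>?G\<^esub> b" for a b :: int
    proof
      assume "?r = ?s [^]\<^bsub>?G\<^esub> a \<otimes>\<^bsub>?G\<^esub> ?t [^]\<^bsub>?G\<^esub> b"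
      then have "triple (4 * m) 0 0 1 = triple (4 * m) a (a * m + b) 0"
        using hst[of a b] h(3) by simp
      then show False
        unfolding triple_def by simp
    qed
  qed simp_all
qed


section \<open>The seven subgroups\<close>

theorem mainTheorem1:
  fixes n :: nat
    and G (structure)
    and \<sigma> \<tau> \<rho> :: "gen word set set"
    and H :: "nat \<Rightarrow> gen word set set set"
  assumes "n \<ge> 1"
    and "G = Gn n" and "\<sigma> = Gn_sigma n" and "\<tau> = Gn_tau n" and "\<rho> = Gn_rho n"
    and "H 1 = generate G {\<sigma>, \<tau>}"
    and "H 2 = (if n = 1 then generate G {\<sigma>, \<rho>}
                else generate G {\<sigma>, \<tau> [^] (2::nat), \<rho>})"
    and "H 3 = generate G {\<rho>, \<tau>}"
    and "H 4 = (if n = 1 then generate G {\<sigma> \<otimes> \<tau>, \<rho>, \<sigma> [^] (2::nat)}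
                else generate G {\<sigma> \<otimes> \<tau>, \<rho>})"
    and "H 5 = generate G {\<sigma> \<otimes> \<rho>, \<tau>}"
    and "H 6 = (if n = 1 then generate G {\<tau> \<otimes> \<rho>, \<sigma>}
                else generate G {\<tau> \<otimes> \<rho>, \<sigma>, \<tau> [^] (2::nat)})"
    and "H 7 = (if n = 1 then generate G {\<sigma> \<otimes> \<tau>, \<tau> \<otimes> \<rho>, \<sigma> [^] (2::nat)}
                else generate G {\<sigma> \<otimes> \<tau>, \<tau> \<otimes> \<rho>})"
  shows "{K. subgroup K G \<and> card (rcosets K) = 2} = H ` {1..7} \<and>
    card {K. subgroup K G \<and> card (rcosets K) = 2} = 7 \<and>
    (derived G (H 1) = generate G {\<one>} \<and>
     of_type (abelianization G (H 1)) [2 ^ 2, 2 ^ (n + 2)]) \<and>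
    (if n = 1
     then derived G (H 2) = generate G {\<sigma> [^] (2::nat)} \<and>
          of_type (abelianization G (H 2)) [2, 4]
     else derived G (H 2) = generate G {\<sigma> [^] (2::nat), \<tau> [^] (4::nat)} \<and>
          of_type (abelianization G (H 2)) [2, 2, 2]) \<and>
    (derived G (H 3) = generate G {\<tau> [^] (2::nat)} \<and>
     of_type (abelianization G (H 3)) [2, 4]) \<and>
    (if n = 1
     then derived G (H 4) = generate G {(\<sigma> \<otimes> \<tau>) [^] (2::nat), \<sigma> [^] (4::nat)} \<and>
          of_type (abelianization G (H 4)) [2, 2, 2]
     else derived G (H 4) = generate G {(\<sigma> \<otimes> \<tau>) [^] (2::nat)} \<and>
          of_type (abelianization G (H 4)) [2, 4]) \<and>
    (derived G (H 5) = generate G {\<tau> [^] (2::nat)} \<and>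
     of_type (abelianization G (H 5)) [2, 4]) \<and>
    (if n = 1
     then derived G (H 6) = generate G {\<sigma> [^] (2::nat)} \<and>
          of_type (abelianization G (H 6)) [2, 4]
     else derived G (H 6) = generate G {\<sigma> [^] (2::nat), \<tau> [^] (4::nat)} \<and>
          of_type (abelianization G (H 6)) [2, 2, 2]) \<and>
    (if n = 1
     then derived G (H 7) = generate G {\<sigma> [^] (4::nat), (\<sigma> \<otimes> \<tau>) [^] (2::nat)} \<and>
          of_type (abelianization G (H 7)) [2, 2, 2]
     else derived G (H 7) = generate G {(\<sigma> \<otimes> \<tau>) [^] (2::nat)} \<and>
          of_type (abelianization G (H 7)) [2, 4])"
proof -
  interpret Gn_group G n \<sigma> \<tau> \<rho>
    unfolding assms(2-5) by (rule Gn_group_Gn[OF assms(1)])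
  interpret T: Gn_group G n \<sigma> \<tau> "\<tau> \<otimes> \<rho>"
    by (rule Gn_group_t_r)
  interpret S: Gn_group G n "inv \<sigma>" \<tau> "\<sigma> \<otimes> \<rho>"
    by (rule Gn_group_inv_s)
  note H = assms(6-12)
  have H6: "H 6 = (if n = 1 then generate G {\<sigma>, \<tau> \<otimes> \<rho>}
      else generate G {\<sigma>, \<tau> [^] (2::nat), \<tau> \<otimes> \<rho>})"
    unfolding H(6) by (simp add: insert_commute)
  have H7: "H 7 = (if n = 1 then generate G {\<sigma> \<otimes> \<tau>, \<tau> \<otimes> \<rho>, \<sigma> [^] (2::nat)}
      else generate G {\<sigma> \<otimes> \<tau>, \<tau> \<otimes> \<rho>})"
    by (rule H(7))
  have bits1: "parity_set (H 1) \<and> \<sigma> \<in> H 1 \<and> \<tau> \<in> H 1 \<and> \<rho> \<notin> H 1"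
    unfolding H(1) by (rule subgroup_s_t)
  have bits2: "parity_set (H 2) \<and> \<sigma> \<in> H 2 \<and> \<tau> \<notin> H 2 \<and> \<rho> \<in> H 2"
    unfolding H(2) by (rule subgroup_s_t2_r)
  have bits3: "parity_set (H 3) \<and> \<sigma> \<notin> H 3 \<and> \<tau> \<in> H 3 \<and> \<rho> \<in> H 3"
    unfolding H(3) by (rule subgroup_r_t)
  have bits4: "parity_set (H 4) \<and> \<sigma> \<notin> H 4 \<and> \<tau> \<notin> H 4 \<and> \<rho> \<in> H 4"
    unfolding H(4) by (rule subgroup_st_r)
  have "parity_set (H 5) \<and> inv \<sigma> \<notin> H 5 \<and> \<tau> \<in> H 5 \<and> \<sigma> \<otimes> \<rho> \<in> H 5"
    unfolding H(5) by (rule S.subgroup_r_t)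
  then have bits5: "parity_set (H 5) \<and> \<sigma> \<notin> H 5 \<and> \<tau> \<in> H 5 \<and> \<rho> \<notin> H 5"
    using parity_set_mult[of "H 5" \<sigma> \<rho>] parity_set_inv[of "H 5" \<sigma>] s r by blast
  have "parity_set (H 6) \<and> \<sigma> \<in> H 6 \<and> \<tau> \<notin> H 6 \<and> \<tau> \<otimes> \<rho> \<in> H 6"
    unfolding H6 by (rule T.subgroup_s_t2_r)
  then have bits6: "parity_set (H 6) \<and> \<sigma> \<in> H 6 \<and> \<tau> \<notin> H 6 \<and> \<rho> \<notin> H 6"
    using parity_set_mult[of "H 6" \<tau> \<rho>] t r by blast
  have "parity_set (H 7) \<and> \<sigma> \<notin> H 7 \<and> \<tau> \<notin> H 7 \<and> \<tau> \<otimes> \<rho> \<in> H 7"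
    unfolding H7 by (rule T.subgroup_st_r)
  then have bits7: "parity_set (H 7) \<and> \<sigma> \<notin> H 7 \<and> \<tau> \<notin> H 7 \<and> \<rho> \<notin> H 7"
    using parity_set_mult[of "H 7" \<tau> \<rho>] t r by blast
  have "parity_set (H i)" if "i \<in> {1..7}" for i
  proof -
    from that have "i = 1 \<or> i = 2 \<or> i = 3 \<or> i = 4 \<or> i = 5 \<or> i = 6 \<or> i = 7" by auto
    then show ?thesis
      using bits1 bits2 bits3 bits4 bits5 bits6 bits7 by (elim disjE) (simp_all only:)
  qed
  then have idx: "{K. subgroup K G \<and> card (rcosets K) = 2} = H ` {1..7}"
      "card {K. subgroup K G \<and> card (rcosets K) = 2} = 7"
    using bits1 bits2 bits3 bits4 bits5 bits6 bits7 by (intro index_2_subgroups; simp)+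
  have D7: "generate G {\<sigma> [^] (4::nat), (\<sigma> \<otimes> \<tau>) [^] (2::nat)} =
      generate G {(\<sigma> \<otimes> \<tau>) [^] (2::nat), \<sigma> [^] (4::nat)}"
    by (simp add: insert_commute)
  show ?thesis
    unfolding D7
    by (intro conjI idx subgroup_s_t[folded H(1)] subgroup_s_t2_r(2)[folded H(2)] subgroup_r_t[folded H(3)]
        subgroup_st_r(2)[folded H(4)] S.subgroup_r_t[folded H(5)] T.subgroup_s_t2_r(2)[folded H6] T.subgroup_st_r(2)[folded H7])
qed

end
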